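(* Let $p$ be a prime, $r>1$ an integer, and let $\mathcal{C}$ be a convolutional code of length $n$ over $\mathbb{Z}_{p^r}((D))$. Then $$p\text{-}\dim(\mathcal{C})+p\text{-}\dim(\mathcal{C}^{\perp})=p\text{-}\dim\big(\mathbb{Z}_{p^r}^n((D))\big)=nr.$$
   Context: $\mathbb{Z}_{p^r}$ is the ring of integers modulo $p^r$; $\mathbb{Z}_{p^r}[D]$ and $\mathbb{Z}_{p^r}((D))$ are the rings of polynomials and of Laurent series (finitely many negative powers of $D$) over it. Vectors are row vectors. A convolutional code $\mathcal{C}$ of length $n$ over $\mathbb{Z}_{p^r}((D))$ is a $\mathbb{Z}_{p^r}((D))$-submodule of $\mathbb{Z}_{p^r}^n((D))$ for which there is a polynomial matrix $G(D)\in\mathbb{Z}_{p^r}^{\tilde k\times n}[D]$ (for some $\tilde k$) with $\mathcal{C}=\{u(D)G(D): u(D)\in\mathbb{Z}_{p^r}^{\tilde k}((D))\}$. The dual (orthogonal) is $\mathcal{C}^{\perp}=\{y\in\mathbb{Z}_{p^r}^n((D)) : [y,x]=0 \text{ for all } x\in\mathcal{C}\}$, where $[y,x]=\sum_{i=1}^n y_ix_i\in\mathbb{Z}_{p^r}((D))$. Let $\mathcal{A}_p=\{0,1,\dots,p-1\}\subset\mathbb{Z}_{p^r}$, and let $\mathcal{A}_p((D))$ be the set of Laurent series with all coefficients in $\mathcal{A}_p$. A $p$-linear combination of vectors $v_1,\dots,v_k$ is a vector $\sum_j a_jv_j$ with $a_j\in\mathcal{A}_p((D))$. An ordered sequence $(v_1,\dots,v_k)$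 is a $p$-generator sequence if $p\,v_i$ is a $p$-linear combination of $v_{i+1},\dots,v_k$ for $i=1,\dots,k-1$ and $p\,v_k=0$; it is $p$-linearly independent if the only $p$-linear combination equal to $0$ is the one with all coefficients zero. A $p$-basis of $\mathcal{C}$ is a $p$-linearly independent $p$-generator sequence whose set of $p$-linear combinations is exactly $\mathcal{C}$. A $p$-encoder of $\mathcal{C}$ is a polynomial matrix $G(D)\in\mathbb{Z}_{p^r}^{k\times n}[D]$ whose rows form a $p$-basis of $\mathcal{C}$, so that $\mathcal{C}=\{u(D)G(D):u(D)\in\mathcal{A}_p^k((D))\}$. The $p$-dimension $p\text{-}\dim(\mathcal{C})$ is the number $k$ of rows of a $p$-encoder of $\mathcal{C}$ (this number does not depend on the $p$-encoder). *)

theory Defs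
  imports
    "HOL-Computational_Algebra.Formal_Laurent_Series"
    "HOL-Computational_Algebra.Polynomial_FPS"
    "Berlekamp_Zassenhaus.Finite_Field"
    "Jordan_Normal_Form.Matrix"
begin

text \<open>
  The ring of integers modulo \<open>p\<^sup>r\<close> is \<open>'a mod_ring\<close> for an index type \<open>'a\<close> with
  \<open>CARD('a) = p ^ r\<close>, and Laurent series over it are \<open>'a mod_ring fls\<close>.  Vectors of Laurent
  series stand for Laurent series with vector coefficients.  The parameters \<open>p\<close> and \<open>n\<close> of the
  definitions below are the prime and the length.
\<close>

definition fls_of_poly :: "'a::zero poly \<Rightarrow> 'a fls" where
  "fls_of_poly f = fps_to_fls (fps_of_poly f)"

text \<open>Vectors are row vectors, so \<open>u G\<close> is rendered as the transpose of \<open>G\<close> applied to \<open>u\<close>.\<close>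

definition row_mult :: "'a::comm_semiring_1 fls vec \<Rightarrow> 'a poly mat \<Rightarrow> 'a fls vec" where
  "row_mult u G = transpose_mat (map_mat fls_of_poly G) *\<^sub>v u"

definition conv_code :: "nat \<Rightarrow> 'a::comm_ring_1 fls vec set \<Rightarrow> bool" where
  "conv_code n C \<longleftrightarrow> (\<exists>k. \<exists>G \<in> carrier_mat k n. C = {row_mult u G |u. u \<in> carrier_vec k})"

text \<open>The submodule property need not be demanded separately, since it follows:\<close>

lemma conv_code_submodule:
  assumes "conv_code n C"
  shows "C \<subseteq> carrier_vec n" "0\<^sub>v n \<in> C"
    "\<And>x y. x \<in> C \<Longrightarrow> y \<in> C \<Longrightarrow> x + y \<in> C" "\<And>c x. x \<in> C \<Longrightarrow> c \<cdot>\<^sub>v x \<in> C"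
proof -
  obtain k G where G: "G \<in> carrier_mat k n"
    and C: "C = {row_mult u G |u. u \<in> carrier_vec k}"
    using assms unfolding conv_code_def by blast
  define H where "H = transpose_mat (map_mat fls_of_poly G)"
  have H: "H \<in> carrier_mat n k" using G by (simp add: H_def)
  have C': "C = {H *\<^sub>v u |u. u \<in> carrier_vec k}" unfolding C row_mult_def H_def ..
  show "C \<subseteq> carrier_vec n" using H unfolding C' by auto
  have "H *\<^sub>v 0\<^sub>v k = 0\<^sub>v n" using H by (intro eq_vecI) auto
  then show "0\<^sub>v n \<in> C" unfolding C' using zero_carrier_vec by (metis (mono_tags, lifting) mem_Collect_eq)
  show "x + y \<in> C" if xy: "x \<in> C" "y \<in> C" for x y
  proof -
    obtain u v where "x = H *\<^sub>v u" "y = H *\<^sub>v v" "u \<in> carrier_vec k" "v \<in> carrier_vec k"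
      using xy unfolding C' by blast
    then have "x + y = H *\<^sub>v (u + v)" "u + v \<in> carrier_vec k"
      using H by (auto simp: mult_add_distrib_mat_vec)
    then show ?thesis unfolding C' by blast
  qed
  show "c \<cdot>\<^sub>v x \<in> C" if x: "x \<in> C" for c x
  proof -
    obtain u where "x = H *\<^sub>v u" "u \<in> carrier_vec k" using x unfolding C' by blast
    then have "c \<cdot>\<^sub>v x = H *\<^sub>v (c \<cdot>\<^sub>v u)" "c \<cdot>\<^sub>v u \<in> carrier_vec k"
      using H by (auto simp: mult_mat_vec)
    then show ?thesis unfolding C' by blast
  qed
qed

definition dual_code :: "nat \<Rightarrow> 'a::comm_ring_1 fls vec set \<Rightarrow> 'a fls vec set" where
  "dual_code n C = {y \<in> carrier_vec n. \<forall>x \<in> C. y \<bullet> x = 0}"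

definition digits :: "nat \<Rightarrow> 'a::comm_ring_1 set" where
  "digits p = of_nat ` {..<p}"

definition digit_series :: "nat \<Rightarrow> 'a::comm_ring_1 fls set" where
  "digit_series p = {f. \<forall>m. fls_nth f m \<in> digits p}"

definition lin_comb ::
  "nat \<Rightarrow> (nat \<Rightarrow> 'a::comm_ring_1 fls) \<Rightarrow> 'a fls vec list \<Rightarrow> 'a fls vec" where
  "lin_comb n a vs = finsum_vec TYPE('a fls) n (\<lambda>j. a j \<cdot>\<^sub>v vs ! j) {..<length vs}"

definition p_combinations ::
  "nat \<Rightarrow> nat \<Rightarrow> 'a::comm_ring_1 fls vec list \<Rightarrow> 'a fls vec set" where
  "p_combinations p n vs = {lin_comb n a vs |a. \<forall>j < length vs. a j \<in> digit_series p}"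

text \<open>Indices start at 0, and the empty sequence is allowed: it is the \<open>p\<close>-basis of the zero code.\<close>

definition p_generator_seq :: "nat \<Rightarrow> nat \<Rightarrow> 'a::comm_ring_1 fls vec list \<Rightarrow> bool" where
  "p_generator_seq p n vs \<longleftrightarrow> set vs \<subseteq> carrier_vec n \<and>
     (\<forall>i. Suc i < length vs \<longrightarrow> of_nat p \<cdot>\<^sub>v vs ! i \<in> p_combinations p n (drop (Suc i) vs)) \<and>
     (vs \<noteq> [] \<longrightarrow> of_nat p \<cdot>\<^sub>v last vs = 0\<^sub>v n)"

definition p_lin_independent :: "nat \<Rightarrow> nat \<Rightarrow> 'a::comm_ring_1 fls vec list \<Rightarrow> bool" where
  "p_lin_independent p n vs \<longleftrightarrow>
     (\<forall>a. (\<forall>j < length vs. a j \<in> digit_series p) \<and> lin_comb n a vs = 0\<^sub>v n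
        \<longrightarrow> (\<forall>j < length vs. a j = 0))"

definition p_basis ::
  "nat \<Rightarrow> nat \<Rightarrow> 'a::comm_ring_1 fls vec set \<Rightarrow> 'a fls vec list \<Rightarrow> bool" where
  "p_basis p n C vs \<longleftrightarrow>
     p_generator_seq p n vs \<and> p_lin_independent p n vs \<and> p_combinations p n vs = C"

definition p_encoder ::
  "nat \<Rightarrow> nat \<Rightarrow> 'a::comm_ring_1 fls vec set \<Rightarrow> nat \<Rightarrow> 'a poly mat \<Rightarrow> bool" where
  "p_encoder p n C k G \<longleftrightarrow>
     G \<in> carrier_mat k n \<and> p_basis p n C (rows (map_mat fls_of_poly G))"

text \<open>
  The \<open>p\<close>-dimension is meaningful only for sets that have a \<open>p\<close>-encoder and whose \<open>p\<close>-encoders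
  all have the same number of rows; \<open>has_p_dim\<close> expresses this.
\<close>

definition has_p_dim :: "nat \<Rightarrow> nat \<Rightarrow> 'a::comm_ring_1 fls vec set \<Rightarrow> bool" where
  "has_p_dim p n C \<longleftrightarrow> (\<exists>!k. \<exists>G. p_encoder p n C k G)"

definition p_dim :: "nat \<Rightarrow> nat \<Rightarrow> 'a::comm_ring_1 fls vec set \<Rightarrow> nat" where
  "p_dim p n C = (THE k. \<exists>G. p_encoder p n C k G)"

end

theory Submission
  imports Defs "HOL-Library.Function_Algebras"
begin

text \<open>
  Let \<open>R\<close> be the ring of Laurent series over the integers modulo \<open>p\<^sup>r\<close>. A series that is not
  divisible by \<open>p\<close> is a unit of \<open>R\<close>, because it is a nonzero digit series, whose lowest coefficient
  is invertible, plus a multiple of the nilpotent element \<open>p\<close>. So \<open>R\<close> is a local ring with maximal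
  ideal \<open>p R\<close>, and \<open>p\<^sup>r = 0 \<noteq> p\<^bsup>r-1\<^esup>\<close>. The digit series represent the residue classes modulo \<open>p\<close>.
  This makes the \<open>p\<close>-dimension a composition length: the \<open>p\<close>-combinations of each final segment of a
  \<open>p\<close>-basis form a submodule, whose quotient by that of the next shorter segment is
  simple. Conversely, picking one vector for each step of a composition series gives a \<open>p\<close>-basis (\<open>p_basis_iff_comp_series\<close>). Hence
  the number of elements of a \<open>p\<close>-basis is unique by the Jordan-Hoelder theorem
  (\<open>comp_series_length_unique\<close>).

  Polynomial \<open>p\<close>-bases exist for every module spanned by finitely many polynomial vectors: for each
  generator \<open>g\<close> adjoin in turn those of \<open>p\<^bsup>r-1\<^esup> g, \<dots>, p g, g\<close> that are not yet in the span
  (\<open>comp_series_extend\<close>).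

  For the dual, let \<open>M\<close> be a submodule, let \<open>v\<close> be a polynomial vector with \<open>p v \<in> M\<close>, and suppose that
  \<open>M\<^sup>\<bottom>\<close> is spanned by polynomial vectors \<open>y\<^sub>1, y\<^sub>2, \<dots>\<close>. The products \<open>y\<^sub>j \<bullet> v\<close> are annihilated by \<open>p\<close>, so
  \<open>y\<^sub>j \<bullet> v = p\<^bsup>r-1\<^esup> f\<^sub>j\<close> with polynomials \<open>f\<^sub>j\<close>. If \<open>p\<close> divides all \<open>f\<^sub>j\<close>, then \<open>v\<close> imposes no new
  condition; if \<open>f\<^sub>1\<close>, say, is a unit, then \<open>(M + R v)\<^sup>\<bottom>\<close> is spanned by \<open>p y\<^sub>1\<close> and the polynomial
  vectors \<open>f\<^sub>1 y\<^sub>j - f\<^sub>j y\<^sub>1\<close>, and its length is one less than that of \<open>M\<^sup>\<bottom>\<close> (\<open>kernel_of_pairing\<close>).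
  So the dual of a code is again spanned by polynomial vectors, and each step of a composition series
  lowers the length of the dual by at most one. A series of polynomial vectors from \<open>0\<close> through
  \<open>C\<close> up to \<open>R\<^sup>n\<close> has \<open>n r\<close> steps, along which the length of the dual falls from \<open>n r\<close> to \<open>0\<close>; hence every step lowers it by
  exactly one, and the lengths of \<open>C\<close> and of its dual add up to \<open>n r\<close> (\<open>comp_series_length_perp\<close>).
\<close>

section \<open>Composition series over local rings with nilpotent principal maximal ideal\<close>

locale chain_ring =
  fixes \<pi> :: "'b::comm_ring_1" and r :: nat
  assumes dvd_one_if: "\<not> \<pi> dvd x \<Longrightarrow> x dvd 1"
    and length_pos: "r > 0"
    and pow_length: "\<pi> ^ r = 0"
    and pow_pred_length: "\<pi> ^ (r - 1) \<noteq> 0"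
begin

lemma pow_pred_length_times: "\<pi> * \<pi> ^ (r - 1) = 0"
  using pow_length length_pos by (metis Suc_diff_1 power_Suc)

text \<open>
  The powers of \<open>\<pi>\<close> below the \<open>r\<close>-th generate strictly decreasing ideals: multiplying an equality
  \<open>\<pi>\<^sup>e = \<pi>\<^bsup>e+1\<^esup> c\<close> by \<open>\<pi>\<^bsup>r-1-e\<^esup>\<close> would give \<open>\<pi>\<^bsup>r-1\<^esup> = 0\<close>.
\<close>

lemma pow_ne_mult_pow_Suc: "e < r \<Longrightarrow> \<pi> ^ e \<noteq> \<pi> ^ Suc e * c"
proof
  assume e: "e < r" and eq: "\<pi> ^ e = \<pi> ^ Suc e * c"
  have "\<pi> ^ (r - 1) = \<pi> ^ (r - 1 - e) * \<pi> ^ e"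
    using e by (simp flip: power_add)
  also have "\<dots> = \<pi> ^ (r - 1 - e + Suc e) * c"
    by (simp only: eq power_add mult.assoc)
  also have "r - 1 - e + Suc e = r" using e by simp
  finally show False using pow_length pow_pred_length by simp
qed

lemma dvd_if_socle_mult_eq_0:
  assumes "\<pi> ^ (r - 1) * z = 0"
  shows "\<pi> dvd z"
proof (rule ccontr)
  assume "\<not> \<pi> dvd z"
  then obtain w where "1 = z * w" using dvd_one_if unfolding dvd_def by blast
  then have "\<pi> ^ (r - 1) = \<pi> ^ (r - 1) * z * w" by (metis mult.assoc mult_1_right)
  with assms show False using pow_pred_length by simp
qed

end

locale chain_ring_module = chain_ring \<pi> r + Modules.module scale
  for \<pi> :: "'b::comm_ring_1" and r :: nat
    and scale :: "'b \<Rightarrow> 'v::ab_group_add \<Rightarrow> 'v" (infixr \<open>*s\<close> 75)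
begin

lemma mem_span_insert_subspace:
  "subspace M \<Longrightarrow> x \<in> span (insert v M) \<longleftrightarrow> (\<exists>c. x - c *s v \<in> M)"
  using span_breakdown_eq[of x v M] by (metis span_eq_iff)

lemma span_insert_span: "span (insert v (span X)) = span (insert v X)"
  by (simp add: set_eq_iff span_breakdown_eq span_span)

lemma span_insert_ne_0: "v \<notin> span X \<Longrightarrow> span (insert v X) \<noteq> {0}"
  by (metis insertI1 singletonD span_base span_zero)

text \<open>
  Since \<open>\<pi> v \<in> M\<close>, the quotient of \<open>M + R v\<close> by \<open>M\<close> is a vector space of dimension at most one over the residue field:
  a coefficient \<open>c\<close> with \<open>c v \<notin> M\<close> is not divisible by \<open>\<pi>\<close>, hence is a unit. So a submodule \<open>N\<close> that is
  not contained in \<open>M\<close> exceeds \<open>N \<inter> M\<close> by a single simple step, which any \<open>w\<close> in \<open>N\<close> outside \<open>M\<close>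
  provides. For \<open>N = M + R v\<close> this says that \<open>M\<close> is maximal in \<open>N\<close>.
\<close>

lemma simple_quotient:
  assumes M: "subspace M" and v: "\<pi> *s v \<in> M"
    and N: "subspace N" "N \<subseteq> span (insert v M)" and w: "w \<in> N" "w \<notin> M"
  shows "\<pi> *s w \<in> N \<inter> M" and "span (insert w (N \<inter> M)) = N"
proof -
  have NM: "subspace (N \<inter> M)" using M N by (simp add: subspace_inter)
  obtain c where c: "w - c *s v \<in> M" using mem_span_insert_subspace[OF M] N w by blast
  have "\<not> \<pi> dvd c"
  proof
    assume "\<pi> dvd c"
    then obtain e where e: "c = \<pi> * e" by blast
    have "e *s (\<pi> *s v) \<in> M" using M v by (simp only: subspace_scale)
    then have "c *s v \<in> M" by (simp add: e mult.commute)
    then have "(w - c *s v) + c *s v \<in> M" using M c by (simp only: subspace_add)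
    then show False using w by simp
  qed
  then obtain d where d: "c * d = 1" by (metis dvdE dvd_one_if)
  have "\<pi> *s w = \<pi> *s (w - c *s v) + c *s (\<pi> *s v)"
    by (simp add: scale_right_diff_distrib mult.commute)
  also have "\<dots> \<in> M" using M c v by (simp only: subspace_add subspace_scale)
  finally show "\<pi> *s w \<in> N \<inter> M" using N w by (simp add: subspace_scale)
  show "span (insert w (N \<inter> M)) = N"
  proof
    show "span (insert w (N \<inter> M)) \<subseteq> N" using N w by (intro span_minimal) auto
    show "N \<subseteq> span (insert w (N \<inter> M))"
    proof
      fix x assume x: "x \<in> N"
      then obtain b where b: "x - b *s v \<in> M"
        using mem_span_insert_subspace[OF M] N by blast
      have "x - (b * d) *s w = (x - b *s v) - (b * d) *s (w - c *s v)"
      proof -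
        have "b * d * c = b" using d by (simp add: mult.assoc mult.commute[of d])
        then show ?thesis by (simp add: scale_right_diff_distrib)
      qed
      also have "\<dots> \<in> M" using M b c by (simp only: subspace_diff subspace_scale)
      finally have "x - (b * d) *s w \<in> N \<inter> M"
        using N x w by (simp add: subspace_diff subspace_scale)
      then show "x \<in> span (insert w (N \<inter> M))"
        using mem_span_insert_subspace[OF NM] by blast
    qed
  qed
qed

text \<open>
  The list picks one vector for each step of a composition series of the module that it spans. It
  starts with the vector of the top step, in the order in which a \<open>p\<close>-basis is written.
\<close>

fun comp_series :: "'v list \<Rightarrow> bool" where
  "comp_series [] \<longleftrightarrow> True"
| "comp_series (v # vs) \<longleftrightarrow>
     v \<notin> span (set vs) \<and> \<pi> *s v \<in> span (set vs) \<and> comp_series vs"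

text \<open>
  Intersecting a composition series with a submodule gives a series in which each step is simple or
  trivial.
\<close>

lemma comp_series_submodule:
  assumes "comp_series vs" "subspace N" "N \<subseteq> span (set vs)"
  shows "\<exists>ws. comp_series ws \<and> span (set ws) = N"
  using assms
proof (induction vs arbitrary: N)
  case Nil
  then have "N = {0}" using subspace_0 by auto
  then show ?case by (intro exI[of _ "[]"]) simp
next
  case (Cons v vs)
  let ?M = "span (set vs)"
  obtain ws where ws: "comp_series ws" "span (set ws) = N \<inter> ?M"
    using Cons.IH[of "N \<inter> ?M"] Cons.prems by (auto simp: subspace_inter)
  show ?case
  proof (cases "N \<subseteq> ?M")
    case True
    then show ?thesis using ws by (auto simp: Int_absorb2)
  next
    case False
    then obtain w where w: "w \<in> N" "w \<notin> ?M" by blast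
    have "N \<subseteq> span (insert v ?M)" using Cons.prems by (simp add: span_insert_span)
    then have "\<pi> *s w \<in> N \<inter> ?M" "span (insert w (N \<inter> ?M)) = N"
      using simple_quotient[of ?M v N w] Cons.prems w by simp_all
    then have "comp_series (w # ws)" "span (set (w # ws)) = N"
      using ws w span_insert_span[of w "set ws"] by simp_all
    then show ?thesis by blast
  qed
qed

text \<open>
  The Jordan-Hoelder argument: if the two series have different top submodules \<open>M\<close> and \<open>N\<close>, neither
  of these contains the other, because both are maximal in \<open>U\<close>. A composition series of \<open>M \<inter> N\<close> then
  extends by one step to \<open>M\<close> and by one step to \<open>N\<close>, so that the induction hypothesis applies to \<open>M\<close>
  and to \<open>N\<close>.
\<close>

theorem comp_series_length_unique:
  assumes "comp_series vs" "comp_series ws" "span (set vs) = span (set ws)"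
  shows "length vs = length ws"
  using assms
proof (induction "length vs" arbitrary: vs ws)
  case 0
  then have "vs = []" by simp
  with 0 show ?case using span_insert_ne_0 by (cases ws) auto
next
  case (Suc k)
  obtain v vs' where vs: "vs = v # vs'" "length vs' = k" using Suc(2) by (metis length_Suc_conv)
  obtain w ws' where ws: "ws = w # ws'" using Suc.prems vs span_insert_ne_0 by (cases ws) auto
  define M where "M = span (set vs')"
  define N where "N = span (set ws')"
  define U where "U = span (set vs)"
  have sub: "subspace M" "subspace N" "subspace U" by (simp_all add: M_def N_def U_def)
  have U: "U = span (insert v M)" "U = span (insert w N)"
    using Suc.prems by (simp_all add: U_def M_def N_def vs ws span_insert_span)
  have v: "v \<notin> M" "\<pi> *s v \<in> M" "comp_series vs'" and w: "w \<notin> N" "\<pi> *s w \<in> N" "comp_series ws'"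
    using Suc.prems by (simp_all add: vs ws M_def N_def)
  have MU: "M \<subseteq> U" "N \<subseteq> U" "v \<in> U" "w \<in> U"
    unfolding U by (auto intro: span_base) (metis U insertI1 insertI2 span_base)+
  show ?case
  proof (cases "M = N")
    case True
    then show ?thesis using Suc.hyps(1)[of vs' ws'] v w vs ws by (simp add: M_def N_def)
  next
    case False
    have "\<not> N \<subseteq> M"
    proof
      assume NM: "N \<subseteq> M"
      then obtain x where x: "x \<in> M" "x \<notin> N" using False by blast
      have "U = span (insert x (U \<inter> N))"
        using simple_quotient(2)[of N w U x] sub w U x MU by (metis order_refl subsetD)
      also have "\<dots> \<subseteq> M" using x sub NM MU by (intro span_minimal) auto
      finally show False using v MU by auto
    qed
    moreover have "\<not> M \<subseteq> N"
    proof
      assume NM: "M \<subseteq> N"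
      then obtain x where x: "x \<in> N" "x \<notin> M" using False by blast
      have "U = span (insert x (U \<inter> M))"
        using simple_quotient(2)[of M v U x] sub v U x MU by (metis order_refl subsetD)
      also have "\<dots> \<subseteq> N" using x sub NM MU by (intro span_minimal) auto
      finally show False using w MU by auto
    qed
    ultimately obtain x y where x: "x \<in> N" "x \<notin> M" and y: "y \<in> M" "y \<notin> N" by blast
    obtain ts where ts: "comp_series ts" "span (set ts) = M \<inter> N"
      using comp_series_submodule[of vs' "M \<inter> N"] v sub by (auto simp: M_def subspace_inter)
    have xs: "\<pi> *s x \<in> N \<inter> M" "span (insert x (N \<inter> M)) = N"
      using simple_quotient[of M v N x] sub v x MU U by simp_all
    have ys: "\<pi> *s y \<in> M \<inter> N" "span (insert y (M \<inter> N)) = M"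
      using simple_quotient[of N w M y] sub w y MU U by simp_all
    have cx: "comp_series (x # ts)" "span (set (x # ts)) = span (set ws')"
      using xs x ts span_insert_span[of x "set ts"] by (simp_all add: Int_commute flip: N_def)
    have cy: "comp_series (y # ts)" "span (set (y # ts)) = span (set vs')"
      using ys y ts span_insert_span[of y "set ts"] by (simp_all flip: M_def)
    have "length vs' = length (y # ts)" using Suc.hyps(1)[of vs' "y # ts"] v cy vs by simp
    moreover have "length (x # ts) = length ws'"
      using Suc.hyps(1)[of "x # ts" ws'] w cx vs calculation by simp
    ultimately show ?thesis by (simp add: vs ws)
  qed
qed

lemma span_insert_redundant: "x \<in> span X \<Longrightarrow> span (insert x X) = span X"
  by (metis insert_absorb span_insert_span span_span)

text \<open>
  Between the span of \<open>ws\<close> and its sum with \<open>R y\<close>, the vectors \<open>\<pi>\<^bsup>r-1\<^esup> y, \<dots>, \<pi> y, y\<close> are added in this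
  order, omitting those that are already in the span. The set \<open>L\<close> will be the set of polynomial vectors.
\<close>

lemma comp_series_extend_by:
  assumes L: "\<And>x. x \<in> L \<Longrightarrow> \<pi> *s x \<in> L"
    and ws: "comp_series ws" "set ws \<subseteq> L" and y: "y \<in> L"
  shows "\<exists>us. comp_series (us @ ws) \<and> set us \<subseteq> L \<and>
           span (set (us @ ws)) = span (insert y (set ws))"
proof -
  have pow: "\<pi> ^ k *s y \<in> L" for k
  proof (induction k)
    case (Suc k)
    then show ?case using L by fastforce
  qed (simp add: y)
  have "\<exists>us. comp_series (us @ ws) \<and> set us \<subseteq> L \<and>
          span (set (us @ ws)) = span (insert (\<pi> ^ (r - e) *s y) (set ws))" if "e \<le> r" for e
    using that
  proof (induction e)
    case 0
    show ?case using ws by (intro exI[of _ "[]"]) (simp add: pow_length span_insert_redundant[OF span_zero])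
  next
    case (Suc e)
    define z where "z = \<pi> ^ (r - Suc e) *s y"
    have "\<pi> *s z = \<pi> ^ (r - e) *s y"
      using Suc.prems by (simp add: z_def Suc_diff_Suc flip: power_Suc)
    then obtain us where us: "comp_series (us @ ws)" "set us \<subseteq> L"
      and span_us: "span (set (us @ ws)) = span (insert (\<pi> *s z) (set ws))"
      using Suc by auto
    have pz: "\<pi> *s z \<in> span (set (us @ ws))" by (simp only: span_us) (simp add: span_base)
    have "span (insert z (set (us @ ws))) = span (insert z (insert (\<pi> *s z) (set ws)))"
      by (metis span_us span_insert_span)
    also have "\<dots> = span (insert z (set ws))"
      by (subst insert_commute, rule span_insert_redundant) (simp add: span_base span_scale)
    finally have z: "span (insert z (set (us @ ws))) = span (insert z (set ws))" .
    show ?case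
    proof (cases "z \<in> span (set (us @ ws))")
      case True
      then have "span (set (us @ ws)) = span (insert z (set ws))"
        using span_insert_redundant z by metis
      with us show ?thesis unfolding z_def by blast
    next
      case False
      then have "comp_series ((z # us) @ ws)" using us pz by simp
      moreover have "set (z # us) \<subseteq> L" using us pow by (simp add: z_def)
      moreover have "span (set ((z # us) @ ws)) = span (insert z (set ws))" using z by simp
      ultimately show ?thesis unfolding z_def by blast
    qed
  qed
  from this[of r] show ?thesis by simp
qed

lemma comp_series_extend:
  assumes L: "\<And>x. x \<in> L \<Longrightarrow> \<pi> *s x \<in> L"
    and ws: "comp_series ws" "set ws \<subseteq> L" and Y: "finite Y" "Y \<subseteq> L"
  shows "\<exists>us. comp_series (us @ ws) \<and> set us \<subseteq> L \<and>
           span (set (us @ ws)) = span (Y \<union> set ws)"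
  using Y
proof (induction Y rule: finite_induct)
  case empty
  show ?case using ws by (intro exI[of _ "[]"]) simp
next
  case (insert y Y)
  then obtain us where us: "comp_series (us @ ws)" "set us \<subseteq> L"
    "span (set (us @ ws)) = span (Y \<union> set ws)" by auto
  obtain us' where us': "comp_series (us' @ us @ ws)" "set us' \<subseteq> L"
    "span (set (us' @ us @ ws)) = span (insert y (set (us @ ws)))"
    using comp_series_extend_by[OF L, of "us @ ws" y] us ws insert.prems by auto
  have "span (insert y (set (us @ ws))) = span (insert y Y \<union> set ws)"
    by (metis us(3) span_insert_span Un_insert_left)
  then show ?case using us us' by (intro exI[of _ "us' @ us"]) simp
qed

end

section \<open>The length of the dual module\<close>

text \<open>
  Vectors of length \<open>n\<close> are modelled as functions that vanish from \<open>n\<close> on. They form a submodule of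
  the module of all functions, whose type is an abelian group, so that the theory of spans applies.
\<close>

definition fun_scale :: "'b::comm_ring_1 \<Rightarrow> (nat \<Rightarrow> 'b) \<Rightarrow> nat \<Rightarrow> 'b" where
  "fun_scale c f = (\<lambda>i. c * f i)"

lemma module_fun_scale: "Modules.module fun_scale"
  by unfold_locales (auto simp: fun_scale_def fun_eq_iff algebra_simps)

definition funs_below :: "nat \<Rightarrow> (nat \<Rightarrow> 'b::comm_ring_1) set" where
  "funs_below n = {f. \<forall>i\<ge>n. f i = 0}"

definition unit_fun :: "nat \<Rightarrow> nat \<Rightarrow> 'b::comm_ring_1" where
  "unit_fun i = (\<lambda>j. if j = i then 1 else 0)"

definition pairing :: "nat \<Rightarrow> (nat \<Rightarrow> 'b::comm_ring_1) \<Rightarrow> (nat \<Rightarrow> 'b) \<Rightarrow> 'b" where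
  "pairing n f g = (\<Sum>i<n. f i * g i)"

definition perp :: "nat \<Rightarrow> (nat \<Rightarrow> 'b::comm_ring_1) set \<Rightarrow> (nat \<Rightarrow> 'b) set" where
  "perp n X = {y \<in> funs_below n. \<forall>x\<in>X. pairing n y x = 0}"

lemma pairing_simps [simp]:
  "pairing n 0 g = 0" "pairing n f 0 = 0"
  "pairing n (f + f') g = pairing n f g + pairing n f' g"
  "pairing n f (g + g') = pairing n f g + pairing n f g'"
  "pairing n (f - f') g = pairing n f g - pairing n f' g"
  "pairing n (fun_scale c f) g = c * pairing n f g"
  "pairing n f (fun_scale c g) = c * pairing n f g"
  by (simp_all add: pairing_def fun_scale_def algebra_simps sum.distrib sum_subtractf
      sum_distrib_left)

lemma pairing_unit_fun: "i < n \<Longrightarrow> pairing n f (unit_fun i) = f i"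
  by (simp add: pairing_def unit_fun_def if_distrib[of "(*) _"] cong: if_cong)

lemma unit_fun_mem_funs_below: "i < n \<Longrightarrow> unit_fun i \<in> funs_below n"
  by (auto simp: unit_fun_def funs_below_def)

lemma perp_Cons: "perp n (set (v # vs)) = {y \<in> perp n (set vs). pairing n y v = 0}"
  by (auto simp: perp_def)

text \<open>
  The subring \<open>S\<close> stands for the polynomials. The torsion condition says that an element of \<open>S\<close>
  annihilated by \<open>\<pi>\<close> is a multiple of \<open>\<pi>\<^bsup>r-1\<^esup>\<close> with a cofactor that is again in \<open>S\<close>; it keeps the
  construction of the dual inside the polynomials.
\<close>

locale chain_ring_subring = chain_ring \<pi> r for \<pi> :: "'b::comm_ring_1" and r :: nat +
  fixes S :: "'b set"
  assumes S_closed: "0 \<in> S" "1 \<in> S" "\<pi> \<in> S"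
      "x \<in> S \<Longrightarrow> y \<in> S \<Longrightarrow> x + y \<in> S" "x \<in> S \<Longrightarrow> y \<in> S \<Longrightarrow> x - y \<in> S"
      "x \<in> S \<Longrightarrow> y \<in> S \<Longrightarrow> x * y \<in> S"
    and S_torsion: "x \<in> S \<Longrightarrow> \<pi> * x = 0 \<Longrightarrow> \<exists>f\<in>S. x = \<pi> ^ (r - 1) * f"

sublocale chain_ring_subring \<subseteq> chain_ring_module \<pi> r fun_scale
  by (intro chain_ring_module.intro chain_ring_axioms module_fun_scale)

context chain_ring_subring
begin

definition S_funs_below :: "nat \<Rightarrow> (nat \<Rightarrow> 'b) set" where
  "S_funs_below n = {f \<in> funs_below n. range f \<subseteq> S}"

lemma S_funs_below_closed:
  "f \<in> S_funs_below n \<Longrightarrow> g \<in> S_funs_below n \<Longrightarrow> f - g \<in> S_funs_below n"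
  "c \<in> S \<Longrightarrow> f \<in> S_funs_below n \<Longrightarrow> fun_scale c f \<in> S_funs_below n"
  "i < n \<Longrightarrow> unit_fun i \<in> S_funs_below n"
  using S_closed
  by (auto simp: S_funs_below_def funs_below_def fun_scale_def unit_fun_def image_subset_iff)

lemma pairing_mem_S: "f \<in> S_funs_below n \<Longrightarrow> g \<in> S_funs_below n \<Longrightarrow> pairing n f g \<in> S"
proof -
  assume fg: "f \<in> S_funs_below n" "g \<in> S_funs_below n"
  have "(\<Sum>i\<in>I. f i * g i) \<in> S" for I
    using fg S_closed by (induction I rule: infinite_finite_induct) (auto simp: S_funs_below_def image_subset_iff)
  then show ?thesis by (simp add: pairing_def)
qed

lemma subspace_funs_below: "subspace (funs_below n)"
  by (auto simp: subspace_def funs_below_def fun_scale_def)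

lemma perp_span: "perp n (span X) = perp n X"
proof -
  have "pairing n y x = 0" if y: "\<forall>x\<in>X. pairing n y x = 0" and x: "x \<in> span X" for x y
  proof -
    have "span X \<subseteq> {x. pairing n y x = 0}" using y by (intro span_minimal) (auto simp: subspace_def)
    then show ?thesis using x by auto
  qed
  then show ?thesis by (auto simp: perp_def span_base)
qed

lemma span_unit_funs: "span (unit_fun ` {..<n}) = funs_below n"
proof
  show "span (unit_fun ` {..<n}) \<subseteq> funs_below n"
    by (intro span_minimal) (auto simp: subspace_funs_below unit_fun_mem_funs_below)
  show "funs_below n \<subseteq> span (unit_fun ` {..<n})"
  proof
    fix f :: "nat \<Rightarrow> 'b" assume f: "f \<in> funs_below n"
    have sum_apply: "(\<Sum>i\<in>I. g i) j = (\<Sum>i\<in>I. g i j)" for I j and g :: "nat \<Rightarrow> nat \<Rightarrow> 'b"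
      by (induction I rule: infinite_finite_induct) auto
    have "f = (\<Sum>i<n. fun_scale (f i) (unit_fun i))"
      using f by (auto simp: fun_eq_iff sum_apply fun_scale_def unit_fun_def funs_below_def
          if_distrib[of "(*) _"] cong: if_cong)
    also have "\<dots> \<in> span (unit_fun ` {..<n})"
      by (intro span_sum span_scale span_base) auto
    finally show "f \<in> span (unit_fun ` {..<n})" .
  qed
qed

lemma perp_funs_below: "perp n (funs_below n) = {0 :: nat \<Rightarrow> 'b}"
proof
  show "perp n (funs_below n) \<subseteq> {0 :: nat \<Rightarrow> 'b}"
  proof
    fix y :: "nat \<Rightarrow> 'b" assume y: "y \<in> perp n (funs_below n)"
    have "y i = 0" for i
    proof (cases "i < n")
      case True
      then show ?thesis using y unit_fun_mem_funs_below[of i n] pairing_unit_fun[of i n y]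
        by (auto simp: perp_def)
    next
      case False
      then show ?thesis using y by (auto simp: perp_def funs_below_def)
    qed
    then show "y \<in> {0}" by (auto simp: fun_eq_iff)
  qed
qed (auto simp: perp_def funs_below_def)

text \<open>
  The last coordinate contributes \<open>r\<close> steps: the functions on \<open>{0..n}\<close> whose last value is divisible
  by \<open>\<pi>\<^bsup>r-e\<^esup>\<close> form a chain of submodules for \<open>e = 0, \<dots>, r\<close>.
\<close>

lemma comp_series_funs_below: "\<exists>vs. comp_series vs \<and> span (set vs) = funs_below n \<and> length vs = n * r"
proof (induction n)
  case 0
  have "funs_below 0 = {0 :: nat \<Rightarrow> 'b}" by (auto simp: funs_below_def fun_eq_iff)
  then show ?case by (intro exI[of _ "[]"]) simp
next
  case (Suc n)
  have "\<exists>vs. comp_series vs \<and> span (set vs) = {f \<in> funs_below (Suc n). \<pi> ^ (r - e) dvd f n} \<and>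
      length vs = n * r + e" if "e \<le> r" for e
    using that
  proof (induction e)
    case 0
    have "(\<forall>i\<ge>n. f i = 0) \<longleftrightarrow> (\<forall>i\<ge>Suc n. f i = 0) \<and> f n = 0" for f :: "nat \<Rightarrow> 'b"
      by (metis le_antisym not_less_eq_eq order_refl Suc_leD)
    then have "funs_below n = {f \<in> funs_below (Suc n). \<pi> ^ r dvd f n}"
      by (auto simp: funs_below_def pow_length)
    then show ?case using Suc.IH by auto
  next
    case (Suc e)
    define m where "m = r - Suc e"
    have m: "r - e = Suc m" "m < r" using Suc.prems by (auto simp: m_def)
    define M where "M k = {f \<in> funs_below (Suc n). \<pi> ^ k dvd f n}" for k
    have sub: "subspace (M k)" for k
      by (auto simp: M_def subspace_def funs_below_def fun_scale_def)
    obtain vs where vs: "comp_series vs" "span (set vs) = M (Suc m)" "length vs = n * r + e"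
      using Suc.IH Suc.prems by (auto simp: m M_def)
    define v where "v = fun_scale (\<pi> ^ m) (unit_fun n)"
    have v: "v n = \<pi> ^ m" "\<And>i. i \<noteq> n \<Longrightarrow> v i = 0"
      by (simp_all add: v_def fun_scale_def unit_fun_def)
    have "v \<notin> M (Suc m)" using pow_ne_mult_pow_Suc[OF m(2)] by (auto simp: M_def v dvd_def)
    moreover have "fun_scale \<pi> v \<in> M (Suc m)"
      by (auto simp: M_def v fun_scale_def funs_below_def)
    ultimately have "comp_series (v # vs)" using vs by simp
    moreover have "span (insert v (M (Suc m))) = M m"
    proof
      show "span (insert v (M (Suc m))) \<subseteq> M m"
      proof (intro span_minimal sub)
        show "insert v (M (Suc m)) \<subseteq> M m"
          using v by (auto simp: M_def funs_below_def intro: dvd_mult_right)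
      qed
      show "M m \<subseteq> span (insert v (M (Suc m)))"
      proof
        fix f assume f: "f \<in> M m"
        then obtain c where "f n = \<pi> ^ m * c" by (auto simp: M_def)
        then have "f - fun_scale c v \<in> M (Suc m)"
          using f by (auto simp: M_def fun_scale_def v funs_below_def mult.commute)
        then show "f \<in> span (insert v (M (Suc m)))"
          using mem_span_insert_subspace[OF sub] by blast
      qed
    qed
    then have "span (set (v # vs)) = M m" using vs span_insert_span[of v "set vs"] by simp
    ultimately show ?case using vs unfolding M_def m_def
      by (intro exI[of _ "v # vs"]) simp
  qed
  from this[of r] have "\<exists>vs. comp_series vs \<and> span (set vs) = funs_below (Suc n) \<and> length vs = n * r + r"
    by simp
  then show ?case by (simp add: add.commute)
qed

text \<open>
  This is the step that computes the dual of \<open>M + R v\<close> from generators \<open>Y\<close> of the dual of \<open>M\<close>: \<open>K\<close> is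
  again spanned by vectors over \<open>S\<close>, and it is all of the span of \<open>Y\<close> or one simple step below it.
\<close>

lemma kernel_of_pairing:
  assumes Y: "finite Y" "Y \<subseteq> S_funs_below n" and v: "v \<in> S_funs_below n"
    and tors: "\<And>y. y \<in> Y \<Longrightarrow> \<pi> * pairing n y v = 0"
  defines "K \<equiv> {y \<in> span Y. pairing n y v = 0}"
  shows "\<exists>Z. finite Z \<and> Z \<subseteq> S_funs_below n \<and> span Z = K \<and>
           (K = span Y \<or> (\<exists>y. y \<notin> K \<and> fun_scale \<pi> y \<in> K \<and> span (insert y K) = span Y))"
proof -
  have subK: "subspace K" by (auto simp: K_def subspace_def span_add span_scale span_zero)
  have "\<forall>y\<in>Y. \<exists>f. f \<in> S \<and> pairing n y v = \<pi> ^ (r - 1) * f"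
    using S_torsion pairing_mem_S Y v tors by (meson subsetD)
  then obtain f where f: "\<And>y. y \<in> Y \<Longrightarrow> f y \<in> S"
    "\<And>y. y \<in> Y \<Longrightarrow> pairing n y v = \<pi> ^ (r - 1) * f y" by metis
  show ?thesis
  proof (cases "\<forall>y\<in>Y. \<pi> dvd f y")
    case True
    have "Y \<subseteq> K"
    proof
      fix y assume y: "y \<in> Y"
      with True obtain c where "f y = \<pi> * c" by blast
      then have "pairing n y v = 0"
        using f(2)[OF y] pow_pred_length_times by (metis mult.assoc mult.commute mult_zero_left)
      then show "y \<in> K" using y by (simp add: K_def span_base)
    qed
    then have "span Y \<subseteq> K" by (intro span_minimal subK)
    then have "K = span Y" by (auto simp: K_def)
    then show ?thesis using Y by auto
  next
    case False
    then obtain z d where z: "z \<in> Y" and d: "f z * d = 1"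
      by (metis dvd_one_if dvdE)
    \<comment> \<open>elimination of \<open>z\<close>: the combination of \<open>y\<close> and \<open>z\<close> on which the pairing with \<open>v\<close> cancels\<close>
    define g where "g y = fun_scale (f z) y - fun_scale (f y) z" for y
    define Z where "Z = insert (fun_scale \<pi> z) (g ` Y)"
    have ZS: "finite Z" "Z \<subseteq> S_funs_below n"
      using Y z f S_closed by (auto simp: Z_def g_def intro!: S_funs_below_closed)
    have z_in: "fun_scale \<pi> z \<in> K"
      using z tors by (simp add: K_def span_base span_scale)
    have "g y \<in> K" if "y \<in> Y" for y
      using that z f by (simp add: K_def g_def span_base span_scale span_diff)
    then have "Z \<subseteq> K" using z_in by (auto simp: Z_def)
    then have ZK: "span Z \<subseteq> K" by (intro span_minimal subK)
    have "Y \<subseteq> span (insert z Z)"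
    proof
      fix y assume y: "y \<in> Y"
      have "y = fun_scale d (g y) + fun_scale (d * f y) z"
        using d by (simp add: g_def scale_right_diff_distrib mult.commute[of d])
      also have "\<dots> \<in> span (insert z Z)"
        using y by (intro span_add span_scale span_base) (auto simp: Z_def)
      finally show "y \<in> span (insert z Z)" .
    qed
    then have YZ: "span Y \<subseteq> span (insert z Z)" by (intro span_minimal) auto
    have "K \<subseteq> span Z"
    proof
      fix x assume x: "x \<in> K"
      then have "x \<in> span (insert z Z)" using YZ by (auto simp: K_def)
      then obtain c where c: "x - fun_scale c z \<in> span Z" by (auto simp: span_breakdown_eq)
      then have "pairing n (x - fun_scale c z) v = 0" using ZK by (auto simp: K_def)
      then have "\<pi> ^ (r - 1) * (c * f z) = 0" using x f(2)[OF z] by (simp add: K_def algebra_simps)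
      \<comment> \<open>cancelling the unit \<open>f z\<close> shows that only the multiple \<open>\<pi> z\<close> of \<open>z\<close> can occur in \<open>x\<close>\<close>
      then have "\<pi> ^ (r - 1) * (c * f z) * d = 0" by simp
      then have "\<pi> ^ (r - 1) * c = 0" using d by (simp add: mult.assoc)
      then obtain e where "c = \<pi> * e" using dvd_if_socle_mult_eq_0 by blast
      then have "fun_scale c z = fun_scale e (fun_scale \<pi> z)" by (simp add: mult.commute)
      also have "\<dots> \<in> span Z" by (intro span_scale span_base) (simp add: Z_def)
      finally have "(x - fun_scale c z) + fun_scale c z \<in> span Z" using c by (intro span_add)
      then show "x \<in> span Z" by simp
    qed
    then have ZK: "span Z = K" using ZK by blast
    have "pairing n z v \<noteq> 0"
    proof
      assume "pairing n z v = 0"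
      then have "\<pi> ^ (r - 1) * f z * d = 0" using f z by simp
      then show False using d pow_pred_length by (simp add: mult.assoc)
    qed
    then have "z \<notin> K" by (simp add: K_def)
    moreover have "span (insert z K) = span Y"
    proof
      show "span (insert z K) \<subseteq> span Y"
        using z by (intro span_minimal) (auto simp: K_def span_base)
      show "span Y \<subseteq> span (insert z K)"
        using YZ ZK span_insert_span by metis
    qed
    ultimately show ?thesis using ZS ZK z_in by blast
  qed
qed

lemma pairing_torsion:
  assumes "fun_scale \<pi> v \<in> span (set vs)" "y \<in> perp n (set vs)"
  shows "\<pi> * pairing n y v = 0"
proof -
  have "y \<in> perp n (span (set vs))" using assms(2) by (simp add: perp_span)
  then have "pairing n y (fun_scale \<pi> v) = 0" using assms(1) unfolding perp_def by blast
  then show ?thesis by simp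
qed

text \<open>
  Starting from the unit vectors, which span the dual of \<open>0\<close>, each step of the series replaces the
  generators by generators of a kernel.
\<close>

lemma perp_generated_by_S_funs:
  assumes "comp_series vs" "set vs \<subseteq> S_funs_below n"
  shows "\<exists>Y. finite Y \<and> Y \<subseteq> S_funs_below n \<and> span Y = perp n (set vs)"
  using assms
proof (induction vs)
  case Nil
  have "perp n (set []) = (funs_below n :: (nat \<Rightarrow> 'b) set)" by (auto simp: perp_def)
  then show ?case using span_unit_funs[of n] S_funs_below_closed(3)
    by (intro exI[of _ "unit_fun ` {..<n}"]) auto
next
  case (Cons v vs)
  then obtain Y where Y: "finite Y" "Y \<subseteq> S_funs_below n" "span Y = perp n (set vs)" by auto
  have "\<pi> * pairing n y v = 0" if "y \<in> Y" for y
    using Cons.prems Y(3) that by (intro pairing_torsion[of v vs]) (auto intro: span_base)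
  then obtain Z where "finite Z" "Z \<subseteq> S_funs_below n" "span Z = {y \<in> span Y. pairing n y v = 0}"
    using kernel_of_pairing[OF Y(1,2), of v] Cons.prems by auto
  then show ?case unfolding perp_Cons Y(3)[symmetric] by blast
qed

lemma comp_series_of_finite:
  assumes "finite Y" "Y \<subseteq> S_funs_below n"
  shows "\<exists>ys. comp_series ys \<and> set ys \<subseteq> S_funs_below n \<and> span (set ys) = span Y"
  using comp_series_extend[of "S_funs_below n" "[]" Y] assms S_funs_below_closed(2) S_closed by auto

lemma comp_series_perp:
  assumes "comp_series vs" "set vs \<subseteq> S_funs_below n"
  shows "\<exists>ys. comp_series ys \<and> set ys \<subseteq> S_funs_below n \<and> span (set ys) = perp n (set vs)"
  using perp_generated_by_S_funs[OF assms] comp_series_of_finite by metis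

text \<open>
  The dual of the span of \<open>v # vs\<close> is the kernel of the pairing with \<open>v\<close> on the dual of the span of
  \<open>vs\<close>, so it is equal to the latter or a single step below it.
\<close>

lemma perp_length_drop_le_1:
  assumes "comp_series (v # vs)" "set (v # vs) \<subseteq> S_funs_below n"
    and ys: "comp_series ys" "span (set ys) = perp n (set vs)"
    and zs: "comp_series zs" "span (set zs) = perp n (set (v # vs))"
  shows "length ys \<le> length zs + 1"
proof -
  obtain Y where Y: "finite Y" "Y \<subseteq> S_funs_below n" "span Y = perp n (set vs)"
    using perp_generated_by_S_funs assms by (metis comp_series.simps(2) set_subset_Cons subset_trans)
  have "\<pi> * pairing n y v = 0" if "y \<in> Y" for y
    using assms(1) Y(3) that by (intro pairing_torsion[of v vs]) (auto intro: span_base)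
  moreover have "span (set zs) = {y \<in> span Y. pairing n y v = 0}"
    by (simp only: zs(2) Y(3) perp_Cons)
  ultimately have "span (set zs) = span Y \<or>
      (\<exists>y. y \<notin> span (set zs) \<and> fun_scale \<pi> y \<in> span (set zs) \<and> span (insert y (span (set zs))) = span Y)"
    using kernel_of_pairing[OF Y(1,2), of v] assms(2) by auto
  then consider "span (set zs) = span (set ys)"
    | y where "comp_series (y # zs)" "span (set (y # zs)) = span (set ys)"
    using zs(1) Y(3) ys(2) span_insert_span by auto
  then show ?thesis
  proof cases
    case 1
    then show ?thesis using comp_series_length_unique[OF zs(1) ys(1)] by simp
  next
    case 2
    then show ?thesis using comp_series_length_unique[OF _ ys(1)] by fastforce
  qed
qed

lemma perp_length_drop:
  assumes "comp_series (us @ vs)" "set (us @ vs) \<subseteq> S_funs_below n"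
    and ys: "comp_series ys" "span (set ys) = perp n (set vs)"
    and zs: "comp_series zs" "span (set zs) = perp n (set (us @ vs))"
  shows "length ys \<le> length zs + length us"
  using assms(1,2) zs
proof (induction us arbitrary: zs)
  case Nil
  then show ?case using comp_series_length_unique[OF ys(1), of zs] ys(2) by simp
next
  case (Cons u us)
  obtain xs where xs: "comp_series xs" "span (set xs) = perp n (set (us @ vs))"
    using comp_series_perp[of "us @ vs" n] Cons.prems by auto
  have "length ys \<le> length xs + length us" using Cons.IH[OF _ _ xs] Cons.prems by auto
  moreover have "length xs \<le> length zs + 1"
    using perp_length_drop_le_1[of u "us @ vs" n xs zs] Cons.prems xs by simp
  ultimately show ?case by simp
qed

text \<open>
  Extend \<open>vs\<close> to a composition series \<open>us @ vs\<close> of the whole module, which has \<open>n * r\<close> steps. The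
  dual shrinks to \<open>0\<close> along \<open>us\<close>, so its length is at most the length of \<open>us\<close>, which gives one
  inequality; along \<open>vs\<close> it shrinks from the whole module to the span of \<open>ys\<close>, which gives the other.
\<close>

theorem comp_series_length_perp:
  assumes vs: "comp_series vs" "set vs \<subseteq> S_funs_below n"
    and ys: "comp_series ys" "span (set ys) = perp n (set vs)"
  shows "length vs + length ys = n * r"
proof (rule antisym)
  obtain bs where bs: "comp_series bs" "span (set bs) = funs_below n" "length bs = n * r"
    using comp_series_funs_below by blast
  obtain us where us: "comp_series (us @ vs)" "set us \<subseteq> S_funs_below n"
    "span (set (us @ vs)) = span (unit_fun ` {..<n} \<union> set vs)"
    using comp_series_extend[of "S_funs_below n" vs "unit_fun ` {..<n}"] vs
      S_funs_below_closed(2,3) S_closed by (metis (no_types, lifting) finite_imageI finite_lessThan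
      image_subsetI lessThan_iff)
  have "span (unit_fun ` {..<n} \<union> set vs) = funs_below n"
  proof
    show "span (unit_fun ` {..<n} \<union> set vs) \<subseteq> funs_below n"
      using vs unit_fun_mem_funs_below
      by (intro span_minimal) (auto simp: subspace_funs_below S_funs_below_def)
    show "funs_below n \<subseteq> span (unit_fun ` {..<n} \<union> set vs)"
      using span_mono[of "unit_fun ` {..<n}"] span_unit_funs by blast
  qed
  then have full: "span (set (us @ vs)) = funs_below n" using us by simp
  then have "perp n (set (us @ vs)) = {0}" using perp_span perp_funs_below by metis
  then have "length ys \<le> length us"
    using us vs ys perp_length_drop[of us vs n ys "[]"] by auto
  moreover have "length (us @ vs) = n * r"
    using comp_series_length_unique[OF us(1) bs(1)] full bs by simp
  ultimately show "length vs + length ys \<le> n * r" by simp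
  have "perp n (set []) = (funs_below n :: (nat \<Rightarrow> 'b) set)" by (auto simp: perp_def)
  then have "length bs \<le> length ys + length vs"
    using vs ys bs by (intro perp_length_drop[of vs "[]" n bs ys]) auto
  then show "n * r \<le> length vs + length ys" using bs by simp
qed

end

section \<open>Laurent series over the integers modulo a prime power\<close>

lemma fls_of_poly_nth: "fls_nth (fls_of_poly f) m = (if m < 0 then 0 else poly.coeff f (nat m))"
  by (simp add: fls_of_poly_def)

lemma fls_of_poly_simps [simp]:
  "fls_of_poly 0 = 0" "fls_of_poly 1 = 1"
  "fls_of_poly (f + g) = fls_of_poly f + fls_of_poly g"
  "fls_of_poly (f' - g') = fls_of_poly f' - fls_of_poly g'"
  "fls_of_poly (a * b) = fls_of_poly a * fls_of_poly b"
  for f g :: "'a::comm_monoid_add poly" and f' g' :: "'b::ab_group_add poly"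
    and a b :: "'c::comm_semiring_1 poly"
  by (simp_all add: fls_of_poly_def fps_of_poly_add fps_of_poly_diff fps_of_poly_mult
      fls_times_fps_to_fls fps_to_fls_plus fps_to_fls_minus)

lemma fls_of_poly_of_nat: "fls_of_poly (of_nat k :: 'a::comm_semiring_1 poly) = of_nat k"
  by (induction k) simp_all

text \<open>
  The condition on \<open>h\<close> keeps the number of negative powers finite.
\<close>

lemma fls_map_coeffs:
  assumes "h 0 = 0"
  obtains g where "\<And>m. fls_nth g m = h (fls_nth f m)"
proof
  show "fls_nth (Abs_fls (\<lambda>m. h (fls_nth f m))) m = h (fls_nth f m)" for m
    using assms by (intro nth_Abs_fls_lower_bound[of "fls_subdegree f"]) simp
qed

locale prime_power_mod_ring =
  fixes p r :: nat and ty :: "'a::nontriv itself"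
  assumes prime: "prime p" and r_pos: "r > 0" and card: "CARD('a) = p ^ r"
begin

lemma of_nat_eq_0_iff_dvd: "of_nat m = (0 :: 'a mod_ring) \<longleftrightarrow> p ^ r dvd m"
proof -
  have "of_nat m = (0 :: 'a mod_ring) \<longleftrightarrow> int m mod int CARD('a) = 0"
    by transfer simp
  also have "\<dots> \<longleftrightarrow> p ^ r dvd m" unfolding card by (metis mod_0_imp_dvd dvd_imp_mod_0 int_dvd_int_iff)
  finally show ?thesis .
qed

lemma ex_of_nat: "\<exists>m. x = (of_nat m :: 'a mod_ring)"
proof -
  have "x = of_nat (nat (to_int_mod_ring x))"
    using range_to_int_mod_ring[where ?'a = 'a] unfolding of_nat_of_int_mod_ring o_def
    by (subst int_nat_eq) (metis atLeastLessThan_iff of_int_mod_ring_to_int_mod_ring rangeI)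
  then show ?thesis by blast
qed

lemma digit_unit:
  assumes "d \<in> digits p" "d \<noteq> (0 :: 'a mod_ring)"
  shows "\<exists>e. d * e = 1"
proof -
  obtain k where k: "d = of_nat k" "k < p" using assms by (auto simp: digits_def)
  then have "\<not> p dvd k" using assms by (auto dest: dvd_imp_le simp: gr0_conv_Suc)
  then have "coprime k (p ^ r)" using prime by (metis coprime_commute coprime_power_right_iff prime_imp_coprime)
  then obtain l where "[k * l = 1] (mod p ^ r)" using cong_solve_coprime_nat by (metis One_nat_def)
  moreover have "of_nat (m mod p ^ r) = (of_nat m :: 'a mod_ring)" for m
  proof -
    have "(of_nat m :: 'a mod_ring) = of_nat (p ^ r) * of_nat (m div p ^ r) + of_nat (m mod p ^ r)"
      by (metis mult_div_mod_eq of_nat_add of_nat_mult)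
    moreover have "of_nat (p ^ r) = (0 :: 'a mod_ring)" by (simp add: of_nat_eq_0_iff_dvd del: of_nat_power)
    ultimately show ?thesis by simp
  qed
  ultimately have "of_nat (k * l) = (of_nat 1 :: 'a mod_ring)" by (metis cong_def)
  then show ?thesis using k by auto
qed

lemma zero_mem_digits: "0 \<in> digits p"
  and one_mem_digits: "1 \<in> digits p"
proof -
  show "0 \<in> digits p"
    unfolding digits_def using prime_gt_0_nat[OF prime] by (intro image_eqI[of _ _ 0]) auto
  show "1 \<in> digits p"
    unfolding digits_def using prime_gt_1_nat[OF prime] by (intro image_eqI[of _ _ 1]) auto
qed

lemma zero_mem_digit_series: "0 \<in> digit_series p"
  and one_mem_digit_series: "1 \<in> digit_series p"
  by (simp_all add: digit_series_def zero_mem_digits one_mem_digits)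

lemma digit_decomposition: "\<exists>d\<in>digits p. \<exists>c. x = d + of_nat p * (c :: 'a mod_ring)"
proof -
  obtain m where "x = of_nat m" using ex_of_nat by blast
  then have "x = of_nat (m mod p) + of_nat p * of_nat (m div p)"
    by (metis mod_mult_div_eq of_nat_add of_nat_mult)
  moreover have "of_nat (m mod p) \<in> digits p"
    using prime_gt_0_nat[OF prime] by (simp add: digits_def)
  ultimately show ?thesis by blast
qed

lemma digit_series_decomposition:
  "\<exists>a\<in>digit_series p. \<exists>g. f = a + of_nat p * (g :: 'a mod_ring fls)"
proof -
  have "\<exists>d c. d \<in> digits p \<and> x = d + of_nat p * c \<and> (x = 0 \<longrightarrow> d = 0 \<and> c = 0)" for x :: "'a mod_ring"
  proof (cases "x = 0")
    case True
    then show ?thesis using zero_mem_digits by (intro exI[of _ 0]) simp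
  next
    case False
    then show ?thesis using digit_decomposition[of x] by auto
  qed
  then obtain d c where dc: "\<And>x :: 'a mod_ring. d x \<in> digits p" "\<And>x. x = d x + of_nat p * c x"
    "d 0 = 0" "c 0 = 0" by metis
  obtain a where a: "\<And>m. fls_nth a m = d (fls_nth f m)" using fls_map_coeffs[of d f] dc by blast
  obtain g where g: "\<And>m. fls_nth g m = c (fls_nth f m)" using fls_map_coeffs[of c f] dc by blast
  have "f = a + of_nat p * g" using dc(2) by (intro fls_eqI) (simp add: a g fls_of_nat)
  moreover have "a \<in> digit_series p" by (simp add: digit_series_def a dc)
  ultimately show ?thesis by blast
qed

text \<open>
  Only the lowest coefficient of a Laurent series has to be invertible. In a nonzero digit series it
  is a nonzero digit, which is prime to \<open>p\<close>.
\<close>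

lemma digit_series_unit:
  assumes "a \<in> digit_series p" "a \<noteq> (0 :: 'a mod_ring fls)"
  shows "\<exists>b. a * b = 1"
proof -
  have "fls_nth a (fls_subdegree a) \<in> digits p" using assms by (simp add: digit_series_def)
  then obtain e where "fls_nth a (fls_subdegree a) * e = 1" using digit_unit assms(2) by fastforce
  then show ?thesis using fls_right_inverse by blast
qed

lemma torsion_coeff: "of_nat p * x = 0 \<Longrightarrow> \<exists>y. x = of_nat (p ^ (r - 1)) * (y :: 'a mod_ring)"
proof -
  assume x: "of_nat p * x = 0"
  obtain m where m: "x = of_nat m" using ex_of_nat by blast
  then have "of_nat (p * m) = (0 :: 'a mod_ring)" using x by simp
  then have "p * p ^ (r - 1) dvd p * m"
    using r_pos unfolding of_nat_eq_0_iff_dvd by (metis Suc_diff_1 power_Suc)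
  then have "p ^ (r - 1) dvd m" using prime_gt_0_nat[OF prime] by simp
  then obtain k where "m = p ^ (r - 1) * k" by blast
  then have "x = of_nat (p ^ (r - 1)) * of_nat k" using m by simp
  then show ?thesis by blast
qed

lemma p_pow_nth: "fls_nth (of_nat p ^ k * f) m = of_nat (p ^ k) * (fls_nth f m)"
  for f :: "'a mod_ring fls"
  by (simp only: fls_mult_of_nat_nth flip: of_nat_power)

lemma p_pow_r: "(of_nat p :: 'a mod_ring fls) ^ r = 0"
  using p_pow_nth[of r 1] by (intro fls_eqI) (simp add: of_nat_eq_0_iff_dvd del: of_nat_power)

text \<open>
  With the digit series \<open>a\<close> of the residue class of \<open>x\<close> and its inverse \<open>b\<close>, the product \<open>x b\<close> has the
  form \<open>1 - t\<close> with \<open>t\<close> nilpotent, so a finite geometric sum inverts it.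
\<close>

lemma dvd_one_if_not_p_dvd:
  assumes "\<not> of_nat p dvd (x :: 'a mod_ring fls)"
  shows "x dvd 1"
proof -
  obtain a g where a: "a \<in> digit_series p" and x: "x = a + of_nat p * g"
    using digit_series_decomposition by blast
  then obtain b where b: "a * b = 1" using assms digit_series_unit by fastforce
  define t where "t = of_nat p * - (g * b)"
  have "t ^ r = 0" using p_pow_r by (simp add: t_def power_mult_distrib del: mult_minus_right)
  then have "1 = (1 - t) * (\<Sum>i<r. t ^ i)" using one_diff_power_eq[of t r] by simp
  moreover have "x * b = 1 - t" using b by (simp add: x t_def algebra_simps)
  ultimately have "1 = x * (b * (\<Sum>i<r. t ^ i))" by (metis mult.assoc)
  then show ?thesis by (rule dvdI)
qed

lemma p_pow_pred_r: "(of_nat p :: 'a mod_ring fls) ^ (r - 1) \<noteq> 0"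
proof
  assume "(of_nat p :: 'a mod_ring fls) ^ (r - 1) = 0"
  then have "of_nat (p ^ (r - 1)) = (0 :: 'a mod_ring)"
    using p_pow_nth[of "r - 1" 1 0] by simp
  then have "p ^ r \<le> p ^ (r - 1)"
    unfolding of_nat_eq_0_iff_dvd using prime_gt_0_nat[OF prime] by (intro dvd_imp_le) auto
  then show False using prime_gt_1_nat[OF prime] r_pos by (simp add: power_increasing_iff)
qed

text \<open>
  A coefficient annihilated by \<open>p\<close> is divisible by \<open>p\<^bsup>r-1\<^esup>\<close>. Choosing the quotient of \<open>0\<close> to be \<open>0\<close> keeps
  the quotient of a polynomial a polynomial.
\<close>

lemma torsion_poly:
  assumes "x \<in> range fls_of_poly" "of_nat p * x = 0"
  shows "\<exists>f\<in>range fls_of_poly. x = of_nat p ^ (r - 1) * (f :: 'a mod_ring fls)"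
proof -
  obtain q where q: "x = fls_of_poly q" using assms by blast
  obtain h where h: "\<And>c :: 'a mod_ring. of_nat p * c = 0 \<Longrightarrow> c = of_nat (p ^ (r - 1)) * h c" "h 0 = 0"
  proof -
    have "\<exists>y. of_nat p * c = 0 \<longrightarrow> c = of_nat (p ^ (r - 1)) * y \<and> (c = 0 \<longrightarrow> y = 0)"
      for c :: "'a mod_ring"
      using torsion_coeff[of c] by (cases "c = 0") auto
    then show thesis using that by (metis mult_zero_right)
  qed
  have "of_nat p * (fls_nth x m) = 0" for m
    using assms(2) by (metis fls_mult_of_nat_nth(1) fls_zero_nth)
  then have "fls_nth x m = of_nat (p ^ (r - 1)) * h (fls_nth x m)" for m by (rule h(1))
  moreover have "fls_nth (fls_of_poly (map_poly h q)) m = h (fls_nth x m)" for m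
    using h(2) by (simp add: q fls_of_poly_nth coeff_map_poly)
  ultimately have "x = of_nat p ^ (r - 1) * fls_of_poly (map_poly h q)"
    by (intro fls_eqI) (metis p_pow_nth)
  then show ?thesis by blast
qed

lemma chain_ring_subring: "chain_ring_subring (of_nat p :: 'a mod_ring fls) r (range fls_of_poly)"
proof
  show "of_nat p \<in> range (fls_of_poly :: 'a mod_ring poly \<Rightarrow> _)"
    by (metis fls_of_poly_of_nat rangeI)
  show "(0 :: 'a mod_ring fls) \<in> range fls_of_poly" "(1 :: 'a mod_ring fls) \<in> range fls_of_poly"
    by (rule range_eqI[of _ _ 0], simp, rule range_eqI[of _ _ 1], simp)
  fix x y :: "'a mod_ring fls"
  assume "x \<in> range fls_of_poly" "y \<in> range fls_of_poly"
  then obtain f g where "x = fls_of_poly f" "y = fls_of_poly g" by blast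
  then have sums: "x + y = fls_of_poly (f + g)" "x - y = fls_of_poly (f - g)" "x * y = fls_of_poly (f * g)"
    by simp_all
  show "x + y \<in> range fls_of_poly" using sums(1) by (rule range_eqI)
  show "x - y \<in> range fls_of_poly" using sums(2) by (rule range_eqI)
  show "x * y \<in> range fls_of_poly" using sums(3) by (rule range_eqI)
next
  fix x :: "'a mod_ring fls"
  show "x dvd 1" if "\<not> of_nat p dvd x" using that by (rule dvd_one_if_not_p_dvd)
  show "\<exists>f\<in>range fls_of_poly. x = of_nat p ^ (r - 1) * f"
    if "x \<in> range fls_of_poly" "of_nat p * x = 0"
    using that by (rule torsion_poly)
qed (rule r_pos p_pow_r p_pow_pred_r)+

end

sublocale prime_power_mod_ring \<subseteq>
  chain_ring_subring "of_nat p :: 'a mod_ring fls" r "range fls_of_poly"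
  by (rule chain_ring_subring)

section \<open>Bases over digit series as composition series\<close>

definition fun_of_vec :: "'b::zero vec \<Rightarrow> nat \<Rightarrow> 'b" where
  "fun_of_vec v = (\<lambda>i. if i < dim_vec v then v $ i else 0)"

lemma fun_of_vec_simps:
  fixes v w :: "'b::comm_ring_1 vec"
  shows "fun_of_vec (0\<^sub>v n :: 'b vec) = 0"
    and "v \<in> carrier_vec n \<Longrightarrow> w \<in> carrier_vec n \<Longrightarrow> fun_of_vec (v + w) = fun_of_vec v + fun_of_vec w"
    and "fun_of_vec (c \<cdot>\<^sub>v v) = fun_scale c (fun_of_vec v)"
  by (auto simp: fun_of_vec_def fun_scale_def fun_eq_iff)

lemma inj_on_fun_of_vec: "inj_on (fun_of_vec :: 'b::zero vec \<Rightarrow> _) (carrier_vec n)"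
proof (rule inj_onI)
  fix v w :: "'b vec"
  assume v: "v \<in> carrier_vec n" and w: "w \<in> carrier_vec n" and eq: "fun_of_vec v = fun_of_vec w"
  show "v = w"
  proof (rule eq_vecI)
    fix i assume "i < dim_vec w"
    then show "v $ i = w $ i" using v w fun_cong[OF eq, of i] by (simp add: fun_of_vec_def)
  qed (use v w in simp)
qed

lemma fun_of_vec_eq_iff:
  "v \<in> carrier_vec n \<Longrightarrow> w \<in> carrier_vec n \<Longrightarrow> fun_of_vec v = fun_of_vec w \<longleftrightarrow> v = w"
  using inj_on_fun_of_vec by (rule inj_on_eq_iff)

lemma fun_of_vec_vec: "f \<in> funs_below n \<Longrightarrow> fun_of_vec (vec n f) = f"
  by (auto simp: fun_of_vec_def funs_below_def)

lemma fun_of_vec_mem_funs_below: "v \<in> carrier_vec n \<Longrightarrow> fun_of_vec v \<in> funs_below n"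
  by (auto simp: fun_of_vec_def funs_below_def)

lemma fun_of_vec_image_carrier_vec: "fun_of_vec ` carrier_vec n = (funs_below n :: (nat \<Rightarrow> 'b::comm_ring_1) set)"
proof (intro subset_antisym subsetI)
  fix f :: "nat \<Rightarrow> 'b" assume "f \<in> funs_below n"
  then show "f \<in> fun_of_vec ` carrier_vec n"
    by (intro image_eqI[of _ _ "vec n f"]) (simp_all add: fun_of_vec_vec)
qed (auto intro: fun_of_vec_mem_funs_below)

lemma pairing_fun_of_vec:
  "v \<in> carrier_vec n \<Longrightarrow> w \<in> carrier_vec n \<Longrightarrow> pairing n (fun_of_vec v) (fun_of_vec w) = v \<bullet> w"
  by (auto simp: pairing_def scalar_prod_def fun_of_vec_def atLeast0LessThan)

lemma fun_of_vec_image_dual_code: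
  assumes "C \<subseteq> carrier_vec n"
  shows "fun_of_vec ` dual_code n C = perp n (fun_of_vec ` C)"
proof
  show "fun_of_vec ` dual_code n C \<subseteq> perp n (fun_of_vec ` C)"
    using assms by (auto simp: dual_code_def perp_def fun_of_vec_mem_funs_below pairing_fun_of_vec subset_iff)
  show "perp n (fun_of_vec ` C) \<subseteq> fun_of_vec ` dual_code n C"
  proof
    fix f assume f: "f \<in> perp n (fun_of_vec ` C)"
    then obtain v where v: "v \<in> carrier_vec n" "f = fun_of_vec v"
      unfolding perp_def fun_of_vec_image_carrier_vec[symmetric] by blast
    have "v \<bullet> x = 0" if "x \<in> C" for x
      using pairing_fun_of_vec[OF v(1), of x] that f assms by (auto simp: perp_def v)
    then show "f \<in> fun_of_vec ` dual_code n C" using v by (auto simp: dual_code_def)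
  qed
qed

lemma lin_comb_carrier: "set vs \<subseteq> carrier_vec n \<Longrightarrow> lin_comb n a vs \<in> carrier_vec n"
  unfolding lin_comb_def by (intro finsum_vec_closed) (auto simp: subset_iff)

lemma lin_comb_Nil: "lin_comb n a [] = 0\<^sub>v n"
  by (simp add: lin_comb_def finsum_vec_empty)

lemma lin_comb_Cons:
  assumes "set (v # vs) \<subseteq> carrier_vec n"
  shows "lin_comb n a (v # vs) = a 0 \<cdot>\<^sub>v v + lin_comb n (\<lambda>j. a (Suc j)) vs"
proof (rule eq_vecI)
  have nth: "lin_comb n a vs $ i = (\<Sum>j<length vs. a j * (vs ! j) $ i)"
    if vs: "set vs \<subseteq> carrier_vec n" and i: "i < n" for i a and vs :: "'a fls vec list"
  proof -
    have "lin_comb n a vs $ i = (\<Sum>j<length vs. (a j \<cdot>\<^sub>v vs ! j) $ i)"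
      unfolding lin_comb_def using that by (intro index_finsum_vec) (auto simp: subset_iff)
    also have "\<dots> = (\<Sum>j<length vs. a j * (vs ! j) $ i)"
    proof (intro sum.cong refl)
      fix j assume "j \<in> {..<length vs}"
      then have "vs ! j \<in> carrier_vec n" using vs by (auto simp: subset_iff)
      then show "(a j \<cdot>\<^sub>v vs ! j) $ i = a j * (vs ! j) $ i" using i by simp
    qed
    finally show ?thesis .
  qed
  have dims: "dim_vec (lin_comb n b ws) = n" if "set ws \<subseteq> carrier_vec n"
    for b and ws :: "'a fls vec list"
    using lin_comb_carrier[OF that] by simp
  show "dim_vec (lin_comb n a (v # vs)) = dim_vec (a 0 \<cdot>\<^sub>v v + lin_comb n (\<lambda>j. a (Suc j)) vs)"
    using assms dims by simp
  fix i assume "i < dim_vec (a 0 \<cdot>\<^sub>v v + lin_comb n (\<lambda>j. a (Suc j)) vs)"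
  then have i: "i < n" using assms dims by simp
  have "(a 0 \<cdot>\<^sub>v v) $ i = a 0 * v $ i" using i assms by (intro index_smult_vec) auto
  then show "lin_comb n a (v # vs) $ i = (a 0 \<cdot>\<^sub>v v + lin_comb n (\<lambda>j. a (Suc j)) vs) $ i"
    using i assms dims nth[of "v # vs" i a] nth[of vs i "\<lambda>j. a (Suc j)"]
    by (simp add: sum.lessThan_Suc_shift del: sum.lessThan_Suc)
qed

lemma p_combinations_carrier: "set vs \<subseteq> carrier_vec n \<Longrightarrow> p_combinations p n vs \<subseteq> carrier_vec n"
  by (auto simp: p_combinations_def lin_comb_carrier)

lemma p_combinations_Nil: "p_combinations p n [] = {0\<^sub>v n}"
  by (auto simp: p_combinations_def lin_comb_Nil)

lemma p_combinations_Cons: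
  assumes "set (v # vs) \<subseteq> carrier_vec n"
  shows "p_combinations p n (v # vs) =
    {c \<cdot>\<^sub>v v + m | c m. c \<in> digit_series p \<and> m \<in> p_combinations p n vs}"
proof (intro subset_antisym subsetI)
  fix x assume "x \<in> p_combinations p n (v # vs)"
  then obtain a where a: "\<forall>j<length (v # vs). a j \<in> digit_series p" "x = lin_comb n a (v # vs)"
    by (auto simp: p_combinations_def)
  then have "a 0 \<in> digit_series p" "\<forall>j<length vs. a (Suc j) \<in> digit_series p" by auto
  then show "x \<in> {c \<cdot>\<^sub>v v + m | c m. c \<in> digit_series p \<and> m \<in> p_combinations p n vs}"
    unfolding a(2) lin_comb_Cons[OF assms] p_combinations_def by blast
next
  fix x assume "x \<in> {c \<cdot>\<^sub>v v + m | c m. c \<in> digit_series p \<and> m \<in> p_combinations p n vs}"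
  then obtain c a where c: "c \<in> digit_series p" and a: "\<forall>j<length vs. a j \<in> digit_series p"
    and x: "x = c \<cdot>\<^sub>v v + lin_comb n a vs" by (auto simp: p_combinations_def)
  have "x = lin_comb n (case_nat c a) (v # vs)" by (simp add: lin_comb_Cons[OF assms] x)
  moreover have "\<forall>j<length (v # vs). case_nat c a j \<in> digit_series p"
    using c a by (auto split: nat.split)
  ultimately show "x \<in> p_combinations p n (v # vs)" unfolding p_combinations_def by blast
qed

lemma p_generator_seq_Nil: "p_generator_seq p n []"
  by (simp add: p_generator_seq_def)

lemma p_generator_seq_Cons:
  "p_generator_seq p n (v # vs) \<longleftrightarrow>
     v \<in> carrier_vec n \<and> of_nat p \<cdot>\<^sub>v v \<in> p_combinations p n vs \<and> p_generator_seq p n vs"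
proof (cases vs)
  case Nil
  then show ?thesis by (auto simp: p_generator_seq_def p_combinations_Nil)
next
  case (Cons w ws)
  have "(\<forall>i. Suc i < length (v # vs) \<longrightarrow>
        of_nat p \<cdot>\<^sub>v (v # vs) ! i \<in> p_combinations p n (drop (Suc i) (v # vs))) \<longleftrightarrow>
      of_nat p \<cdot>\<^sub>v v \<in> p_combinations p n vs \<and>
      (\<forall>i. Suc i < length vs \<longrightarrow> of_nat p \<cdot>\<^sub>v vs ! i \<in> p_combinations p n (drop (Suc i) vs))"
    (is "(\<forall>i. ?P i) \<longleftrightarrow> _")
  proof -
    have "(\<forall>i. ?P i) \<longleftrightarrow> ?P 0 \<and> (\<forall>i. ?P (Suc i))" by (metis not0_implies_Suc)
    then show ?thesis by (simp add: Cons)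
  qed
  then show ?thesis by (auto simp: p_generator_seq_def Cons)
qed

lemma p_generator_seq_carrier: "p_generator_seq p n vs \<Longrightarrow> set vs \<subseteq> carrier_vec n"
  by (simp add: p_generator_seq_def)

context prime_power_mod_ring
begin

text \<open>
  Along a \<open>p\<close>-generator sequence digit coefficients suffice to form the whole span: a coefficient
  \<open>c = a + p g\<close> of the first vector \<open>v\<close> can be replaced by the digit series \<open>a\<close>, since \<open>p v\<close> is in the
  span of the later vectors.
\<close>

lemma p_generator_seq_span:
  fixes vs :: "'a mod_ring fls vec list"
  assumes "p_generator_seq p n vs"
  shows "fun_of_vec ` p_combinations p n vs = span (fun_of_vec ` set vs)"
  using assms
proof (induction vs)
  case Nil
  show ?case by (simp add: p_combinations_Nil fun_of_vec_simps zero_fun_def)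
next
  case (Cons v vs)
  define M where "M = span (fun_of_vec ` set vs)"
  have sub: "subspace M" by (simp add: M_def)
  have carr: "set (v # vs) \<subseteq> carrier_vec n" using Cons.prems by (rule p_generator_seq_carrier)
  have IH: "fun_of_vec ` p_combinations p n vs = M"
    using Cons by (simp add: M_def p_generator_seq_Cons)
  have pv: "fun_scale (of_nat p) (fun_of_vec v) \<in> M"
    using Cons.prems unfolding p_generator_seq_Cons IH[symmetric] fun_of_vec_simps(3)[symmetric] by blast
  have "fun_of_vec ` p_combinations p n (v # vs) =
      {fun_scale c (fun_of_vec v) + m | c m. c \<in> digit_series p \<and> m \<in> M}" (is "_ = ?X")
  proof -
    have sum: "fun_of_vec (c \<cdot>\<^sub>v v + m) = fun_scale c (fun_of_vec v) + fun_of_vec m"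
      if "m \<in> p_combinations p n vs" for c m
      using that carr p_combinations_carrier[of vs n p]
      by (subst fun_of_vec_simps(2)[of _ n]) (auto simp: fun_of_vec_simps(3))
    show ?thesis
      unfolding p_combinations_Cons[OF carr] IH[symmetric] using sum by (auto simp: image_iff) metis+
  qed
  also have "?X = span (insert (fun_of_vec v) M)"
  proof (intro subset_antisym subsetI)
    fix x assume "x \<in> ?X"
    then obtain c m where "x = fun_scale c (fun_of_vec v) + m" "m \<in> M" by blast
    then have "x - fun_scale c (fun_of_vec v) \<in> M" by simp
    then show "x \<in> span (insert (fun_of_vec v) M)"
      using mem_span_insert_subspace[OF sub] by blast
  next
    fix x assume "x \<in> span (insert (fun_of_vec v) M)"
    then obtain c where c: "x - fun_scale c (fun_of_vec v) \<in> M"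
      using mem_span_insert_subspace[OF sub] by blast
    obtain a g where a: "a \<in> digit_series p" "c = a + of_nat p * g"
      using digit_series_decomposition by blast
    have "x - fun_scale a (fun_of_vec v) =
        (x - fun_scale c (fun_of_vec v)) + fun_scale g (fun_scale (of_nat p) (fun_of_vec v))"
      by (simp add: a(2) scale_left_distrib mult.commute)
    also have "\<dots> \<in> M" using sub c pv by (simp only: subspace_add subspace_scale)
    finally have "x - fun_scale a (fun_of_vec v) \<in> M" .
    moreover have "x = fun_scale a (fun_of_vec v) + (x - fun_scale a (fun_of_vec v))" by simp
    ultimately show "x \<in> ?X" using a(1) by blast
  qed
  also have "\<dots> = span (fun_of_vec ` set (v # vs))" by (simp add: M_def span_insert_span)
  finally show ?case .
qed

text \<open>
  If \<open>v\<close> is in the span of the later vectors, then so is \<open>- v\<close>, which is therefore a \<open>p\<close>-combination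
  of them and gives a relation with leading coefficient \<open>1\<close>. Conversely, a relation whose leading
  coefficient is a nonzero digit series can be solved for \<open>v\<close>, as that coefficient is a unit.
\<close>

lemma p_lin_independent_Cons:
  fixes v :: "'a mod_ring fls vec"
  assumes gen: "p_generator_seq p n (v # vs)"
  shows "p_lin_independent p n (v # vs) \<longleftrightarrow>
    fun_of_vec v \<notin> span (fun_of_vec ` set vs) \<and> p_lin_independent p n vs"
proof -
  define M where "M = span (fun_of_vec ` set vs)"
  have sub: "subspace M" by (simp add: M_def)
  have carr: "set (v # vs) \<subseteq> carrier_vec n" using gen by (rule p_generator_seq_carrier)
  have M: "fun_of_vec ` p_combinations p n vs = M"
    using p_generator_seq_span gen by (simp add: M_def p_generator_seq_Cons)
  have comb: "fun_of_vec (lin_comb n a (v # vs)) =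
      fun_scale (a 0) (fun_of_vec v) + fun_of_vec (lin_comb n (\<lambda>j. a (Suc j)) vs)" for a
    unfolding lin_comb_Cons[OF carr] using carr lin_comb_carrier[of vs n]
    by (subst fun_of_vec_simps(2)[of _ n]) (auto simp: fun_of_vec_simps(3))
  have eq0: "lin_comb n a ws = 0\<^sub>v n \<longleftrightarrow> fun_of_vec (lin_comb n a ws) = 0"
    if "set ws \<subseteq> carrier_vec n" for a ws
    using fun_of_vec_eq_iff[OF lin_comb_carrier[OF that] zero_carrier_vec]
    by (simp add: fun_of_vec_simps(1))
  show ?thesis unfolding M_def[symmetric]
  proof (intro iffI conjI)
    assume ind: "p_lin_independent p n (v # vs)"
    have *: "a j = 0" if "j \<le> length vs" "\<And>j. j \<le> length vs \<Longrightarrow> a j \<in> digit_series p"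
      "fun_scale (a 0) (fun_of_vec v) + fun_of_vec (lin_comb n (\<lambda>j. a (Suc j)) vs) = 0" for a j
      using ind that comb[of a] eq0[OF carr, of a] by (simp add: p_lin_independent_def less_Suc_eq_le)
    show "fun_of_vec v \<notin> M"
    proof
      assume "fun_of_vec v \<in> M"
      then have "- fun_of_vec v \<in> M" using sub by (simp add: subspace_neg)
      then obtain a where a: "\<forall>j<length vs. a j \<in> digit_series p"
        "- fun_of_vec v = fun_of_vec (lin_comb n a vs)"
        unfolding M[symmetric] p_combinations_def by auto
      have "case_nat 1 a 0 = 0"
      proof (rule *)
        show "case_nat 1 a j \<in> digit_series p" if "j \<le> length vs" for j
          using that a one_mem_digit_series by (auto split: nat.split)
        show "fun_scale (case_nat 1 a 0) (fun_of_vec v) +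
            fun_of_vec (lin_comb n (\<lambda>j. case_nat 1 a (Suc j)) vs) = 0"
          by (simp flip: a(2))
      qed simp
      then show False by simp
    qed
    show "p_lin_independent p n vs" unfolding p_lin_independent_def
    proof (intro allI impI)
      fix a j
      assume a: "(\<forall>j<length vs. a j \<in> digit_series p) \<and> lin_comb n a vs = 0\<^sub>v n"
        and j: "j < length vs"
      have "case_nat 0 a (Suc j) = 0"
      proof (rule *)
        show "case_nat 0 a j \<in> digit_series p" if "j \<le> length vs" for j
          using that a zero_mem_digit_series by (auto split: nat.split)
        show "fun_scale (case_nat 0 a 0) (fun_of_vec v) +
            fun_of_vec (lin_comb n (\<lambda>j. case_nat 0 a (Suc j)) vs) = 0"
          using a by (simp add: fun_of_vec_simps(1))
      qed (use j in simp)
      then show "a j = 0" by simp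
    qed
  next
    assume hyp: "fun_of_vec v \<notin> M \<and> p_lin_independent p n vs"
    show "p_lin_independent p n (v # vs)" unfolding p_lin_independent_def
    proof (intro allI impI)
      fix a j
      assume a: "(\<forall>j<length (v # vs). a j \<in> digit_series p) \<and> lin_comb n a (v # vs) = 0\<^sub>v n"
        and j: "j < length (v # vs)"
      define m where "m = fun_of_vec (lin_comb n (\<lambda>j. a (Suc j)) vs)"
      have "lin_comb n (\<lambda>j. a (Suc j)) vs \<in> p_combinations p n vs"
        unfolding p_combinations_def using a by (intro CollectI exI conjI refl) auto
      then have m: "m \<in> M" unfolding M[symmetric] m_def by (rule imageI)
      have sum0: "fun_scale (a 0) (fun_of_vec v) + m = 0"
        using a comb[of a] eq0[OF carr, of a] by (simp add: m_def)
      have a0: "a 0 = 0"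
      proof (rule ccontr)
        assume "a 0 \<noteq> 0"
        then obtain b where b: "a 0 * b = 1" using digit_series_unit[of "a 0"] a by auto
        have "fun_of_vec v = fun_scale b (fun_scale (a 0) (fun_of_vec v))"
          using b by (simp add: mult.commute)
        also have "fun_scale (a 0) (fun_of_vec v) = - m" using sum0 by (simp add: eq_neg_iff_add_eq_0)
        also have "fun_scale b (- m) \<in> M" using sub m by (simp only: subspace_scale subspace_neg)
        finally show False using hyp by simp
      qed
      then have "m = 0" using sum0 by simp
      then have "lin_comb n (\<lambda>j. a (Suc j)) vs = 0\<^sub>v n"
        using eq0[of vs] carr by (simp add: m_def)
      moreover have "\<forall>j<length vs. a (Suc j) \<in> digit_series p" using a by auto
      ultimately have "\<forall>j<length vs. a (Suc j) = 0"
        using hyp[THEN conjunct2, unfolded p_lin_independent_def, THEN spec, of "\<lambda>j. a (Suc j)"]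
        by blast
      then show "a j = 0" using a0 j by (cases j) auto
    qed
  qed
qed

text \<open>
  The \<open>p\<close>-generator condition is the requirement that \<open>p v\<close> is in the span of the later vectors, and
  \<open>p\<close>-independence is the requirement that \<open>v\<close> is not; these are the two conditions on a step of a
  composition series.
\<close>

lemma p_basis_iff_comp_series:
  fixes vs :: "'a mod_ring fls vec list"
  assumes C: "C \<subseteq> carrier_vec n"
  shows "p_basis p n C vs \<longleftrightarrow> set vs \<subseteq> carrier_vec n \<and>
    comp_series (map fun_of_vec vs) \<and> span (fun_of_vec ` set vs) = fun_of_vec ` C"
proof -
  have indep: "p_lin_independent p n vs \<longleftrightarrow> comp_series (map fun_of_vec vs)"
    if "p_generator_seq p n vs" for vs :: "'a mod_ring fls vec list"
    using that
  proof (induction vs)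
    case Nil
    show ?case by (simp add: p_lin_independent_def)
  next
    case (Cons v vs)
    then have "p_generator_seq p n vs" and pv: "of_nat p \<cdot>\<^sub>v v \<in> p_combinations p n vs"
      by (simp_all add: p_generator_seq_Cons)
    moreover have "fun_scale (of_nat p) (fun_of_vec v) \<in> span (fun_of_vec ` set vs)"
      using pv p_generator_seq_span[OF calculation(1)] by (metis fun_of_vec_simps(3) image_eqI)
    ultimately show ?case using Cons p_lin_independent_Cons[OF Cons.prems] by simp
  qed
  have gen: "p_generator_seq p n vs"
    if "set vs \<subseteq> carrier_vec n" "comp_series (map fun_of_vec vs)" for vs :: "'a mod_ring fls vec list"
    using that
  proof (induction vs)
    case Nil
    show ?case by (rule p_generator_seq_Nil)
  next
    case (Cons v vs)
    then have vs: "p_generator_seq p n vs" by simp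
    then have "fun_of_vec (of_nat p \<cdot>\<^sub>v v) \<in> fun_of_vec ` p_combinations p n vs"
      using Cons.prems by (simp add: p_generator_seq_span fun_of_vec_simps(3))
    then have "of_nat p \<cdot>\<^sub>v v \<in> p_combinations p n vs"
      using Cons.prems p_combinations_carrier[of vs n p]
      by (subst (asm) inj_on_image_mem_iff[OF inj_on_fun_of_vec[of n]]) auto
    then show ?case using vs Cons.prems by (simp add: p_generator_seq_Cons)
  qed
  have comb: "p_combinations p n vs = C \<longleftrightarrow> span (fun_of_vec ` set vs) = fun_of_vec ` C"
    if "p_generator_seq p n vs"
    using inj_on_image_eq_iff[OF inj_on_fun_of_vec p_combinations_carrier C]
      p_generator_seq_span[OF that] p_generator_seq_carrier[OF that] by metis
  show ?thesis
  proof (cases "p_generator_seq p n vs")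
    case True
    then show ?thesis using p_generator_seq_carrier[OF True]
      by (simp add: p_basis_def indep comb)
  next
    case False
    then show ?thesis using gen[of vs] by (auto simp: p_basis_def)
  qed
qed

end

section \<open>The dimension formula\<close>

context prime_power_mod_ring
begin

lemma ex_p_encoder_iff:
  fixes C :: "'a mod_ring fls vec set"
  assumes C: "C \<subseteq> carrier_vec n"
  shows "(\<exists>G. p_encoder p n C k G) \<longleftrightarrow>
    (\<exists>ws. comp_series ws \<and> set ws \<subseteq> S_funs_below n \<and> span (set ws) = fun_of_vec ` C \<and> length ws = k)"
proof
  assume "\<exists>G. p_encoder p n C k G"
  then obtain G where G: "G \<in> carrier_mat k n" and basis: "p_basis p n C (rows (map_mat fls_of_poly G))"
    by (auto simp: p_encoder_def)
  define ws where "ws = map fun_of_vec (rows (map_mat fls_of_poly G))"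
  have "set ws \<subseteq> S_funs_below n"
  proof
    fix w assume "w \<in> set ws"
    then obtain i where i: "i < k" "w = fun_of_vec (row (map_mat fls_of_poly G) i)"
      using G by (auto simp: ws_def rows_def)
    have "w j \<in> range fls_of_poly" for j
    proof (cases "j < n")
      case True
      then show ?thesis using i G by (simp add: fun_of_vec_def)
    next
      case False
      then show ?thesis using i G S_closed(1) by (simp add: fun_of_vec_def)
    qed
    moreover have "w \<in> funs_below n"
      unfolding i(2) using i(1) G by (intro fun_of_vec_mem_funs_below row_carrier_vec[of _ k]) auto
    ultimately show "w \<in> S_funs_below n" by (auto simp: S_funs_below_def)
  qed
  moreover have "comp_series ws" "span (set ws) = fun_of_vec ` C"
    using basis by (simp_all add: p_basis_iff_comp_series[OF C] ws_def)
  moreover have "length ws = k" using G by (simp add: ws_def)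
  ultimately show "\<exists>ws. comp_series ws \<and> set ws \<subseteq> S_funs_below n \<and>
      span (set ws) = fun_of_vec ` C \<and> length ws = k" by blast
next
  assume "\<exists>ws. comp_series ws \<and> set ws \<subseteq> S_funs_below n \<and>
      span (set ws) = fun_of_vec ` C \<and> length ws = k"
  then obtain ws where ws: "comp_series ws" "set ws \<subseteq> S_funs_below n"
    "span (set ws) = fun_of_vec ` C" "length ws = k" by blast
  define G where "G = mat k n (\<lambda>(i, j). SOME g. fls_of_poly g = (ws ! i) j)"
  have G: "G \<in> carrier_mat k n" by (simp add: G_def)
  have coeff: "fls_of_poly (SOME g. fls_of_poly g = (ws ! i) j) = (ws ! i) j" if "i < k" for i j
  proof -
    have "ws ! i \<in> S_funs_below n" using that ws by (auto simp: subset_iff)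
    then have "(ws ! i) j \<in> range fls_of_poly" by (auto simp: S_funs_below_def image_subset_iff)
    then have "\<exists>g. fls_of_poly g = (ws ! i) j" by (metis imageE)
    then show ?thesis by (rule someI_ex)
  qed
  have "map fun_of_vec (rows (map_mat fls_of_poly G)) = ws"
  proof (rule nth_equalityI)
    show "length (map fun_of_vec (rows (map_mat fls_of_poly G))) = length ws"
      using G ws by simp
    fix i assume "i < length (map fun_of_vec (rows (map_mat fls_of_poly G)))"
    then have i: "i < k" using G by simp
    then have "ws ! i \<in> S_funs_below n" using ws by (auto simp: subset_iff)
    then have zero: "(ws ! i) j = 0" if "\<not> j < n" for j
      using that by (auto simp: S_funs_below_def funs_below_def)
    show "map fun_of_vec (rows (map_mat fls_of_poly G)) ! i = ws ! i"
      using i by (auto simp: fun_eq_iff fun_of_vec_def G_def coeff zero)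
  qed
  moreover have "set (rows (map_mat fls_of_poly G)) \<subseteq> carrier_vec n"
    using G by (auto simp: rows_def)
  ultimately have "p_encoder p n C k G"
    using ws G by (simp add: p_encoder_def p_basis_iff_comp_series[OF C] flip: set_map)
  then show "\<exists>G. p_encoder p n C k G" by blast
qed

text \<open>
  Any composition series by polynomial vectors computes the \<open>p\<close>-dimension, since all series of the same
  module have the same length.
\<close>

lemma p_dim_eq_length:
  fixes C :: "'a mod_ring fls vec set"
  assumes C: "C \<subseteq> carrier_vec n"
    and ws: "comp_series ws" "set ws \<subseteq> S_funs_below n" "span (set ws) = fun_of_vec ` C"
  shows "has_p_dim p n C" and "p_dim p n C = length ws"
proof -
  have ex: "\<exists>G. p_encoder p n C (length ws) G" using ws by (auto simp: ex_p_encoder_iff[OF C])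
  have uniq: "k = length ws" if "\<exists>G. p_encoder p n C k G" for k
    using that ws comp_series_length_unique unfolding ex_p_encoder_iff[OF C] by metis
  show "has_p_dim p n C" unfolding has_p_dim_def using ex uniq by blast
  show "p_dim p n C = length ws" unfolding p_dim_def using ex uniq by (rule the_equality)
qed

text \<open>
  The generators are the rows of the polynomial matrix of the code.
\<close>

lemma conv_code_span:
  fixes C :: "'a mod_ring fls vec set"
  assumes code: "conv_code n C"
  shows "\<exists>Y. finite Y \<and> Y \<subseteq> S_funs_below n \<and> span Y = fun_of_vec ` C"
proof -
  obtain k G where G: "G \<in> carrier_mat k n" and C: "C = {row_mult u G | u. u \<in> carrier_vec k}"
    using code unfolding conv_code_def by blast
  have carr: "C \<subseteq> carrier_vec n" by (rule conv_code_submodule(1)[OF code])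
  define g where "g i = (\<lambda>j. if j < n then fls_of_poly (G $$ (i, j)) else 0)" for i
  have nth: "fun_of_vec (row_mult u G) j = (\<Sum>i<k. u $ i * g i j)" if u: "u \<in> carrier_vec k" for u j
    using u G by (auto simp: fun_of_vec_def row_mult_def g_def scalar_prod_def atLeast0LessThan
        mult.commute intro!: sum.cong)
  have "g ` {..<k} \<subseteq> S_funs_below n"
    using S_closed(1) by (auto simp: S_funs_below_def funs_below_def g_def)
  moreover have "span (g ` {..<k}) = fun_of_vec ` C"
  proof
    have "subspace (fun_of_vec ` C)"
    proof (rule subspaceI)
      show "0 \<in> fun_of_vec ` C"
        using conv_code_submodule(2)[OF code] by (metis fun_of_vec_simps(1) image_eqI)
    next
      fix x y assume "x \<in> fun_of_vec ` C" "y \<in> fun_of_vec ` C"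
      then obtain v w where vw: "v \<in> C" "w \<in> C" "x = fun_of_vec v" "y = fun_of_vec w" by blast
      then have "x + y = fun_of_vec (v + w)" using carr by (simp add: fun_of_vec_simps(2)[of v n w] subsetD)
      then show "x + y \<in> fun_of_vec ` C"
        using conv_code_submodule(3)[OF code vw(1,2)] by (rule image_eqI)
    next
      fix c x assume "x \<in> fun_of_vec ` C"
      then obtain v where v: "v \<in> C" "x = fun_of_vec v" by blast
      then have "fun_scale c x = fun_of_vec (c \<cdot>\<^sub>v v)" by (simp add: fun_of_vec_simps(3))
      then show "fun_scale c x \<in> fun_of_vec ` C"
        using conv_code_submodule(4)[OF code v(1)] by (rule image_eqI)
    qed
    moreover have "g i \<in> fun_of_vec ` C" if i: "i < k" for i
    proof -
      have "fun_of_vec (row_mult (unit_vec k i) G) j = g i j" for j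
        using i by (simp add: nth unit_vec_def if_distrib[of "\<lambda>x. x * _"] cong: if_cong)
      then have "g i = fun_of_vec (row_mult (unit_vec k i) G)" by (simp add: fun_eq_iff)
      moreover have "row_mult (unit_vec k i) G \<in> C"
        unfolding C by (intro CollectI exI[of _ "unit_vec k i"]) simp
      ultimately show ?thesis by (rule image_eqI)
    qed
    ultimately show "span (g ` {..<k}) \<subseteq> fun_of_vec ` C" by (intro span_minimal) auto
    show "fun_of_vec ` C \<subseteq> span (g ` {..<k})"
    proof
      fix f assume "f \<in> fun_of_vec ` C"
      then obtain u where u: "u \<in> carrier_vec k" "f = fun_of_vec (row_mult u G)" by (auto simp: C)
      have sum_apply: "(\<Sum>i\<in>I. h i) j = (\<Sum>i\<in>I. h i j)"
        for I j and h :: "nat \<Rightarrow> nat \<Rightarrow> 'a mod_ring fls"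
        by (induction I rule: infinite_finite_induct) auto
      have "f = (\<Sum>i<k. fun_scale (u $ i) (g i))"
        using u by (auto simp: fun_eq_iff nth sum_apply fun_scale_def)
      also have "\<dots> \<in> span (g ` {..<k})" by (intro span_sum span_scale span_base) auto
      finally show "f \<in> span (g ` {..<k})" .
    qed
  qed
  ultimately show ?thesis by blast
qed

theorem p_dim_duality:
  fixes C :: "'a mod_ring fls vec set"
  assumes "conv_code n C"
  shows "has_p_dim p n C" "has_p_dim p n (dual_code n C)"
    and "p_dim p n C + p_dim p n (dual_code n C) = n * r"
proof -
  have C: "C \<subseteq> carrier_vec n" by (rule conv_code_submodule(1)[OF assms])
  have D: "dual_code n C \<subseteq> carrier_vec n" by (auto simp: dual_code_def)
  obtain ws where ws: "comp_series ws" "set ws \<subseteq> S_funs_below n" "span (set ws) = fun_of_vec ` C"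
    using conv_code_span[OF assms] comp_series_of_finite by metis
  obtain ys where ys: "comp_series ys" "set ys \<subseteq> S_funs_below n" "span (set ys) = perp n (set ws)"
    using comp_series_perp[OF ws(1,2)] by blast
  have "perp n (set ws) = fun_of_vec ` dual_code n C"
    by (simp only: fun_of_vec_image_dual_code[OF C] perp_span flip: ws(3))
  then have ys': "span (set ys) = fun_of_vec ` dual_code n C" using ys(3) by simp
  show "has_p_dim p n C" "has_p_dim p n (dual_code n C)"
    using p_dim_eq_length(1)[OF C ws] p_dim_eq_length(1)[OF D ys(1,2) ys'] by blast+
  show "p_dim p n C + p_dim p n (dual_code n C) = n * r"
    using p_dim_eq_length(2)[OF C ws] p_dim_eq_length(2)[OF D ys(1,2) ys']
      comp_series_length_perp[OF ws(1,2) ys(1,3)] by simp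
qed

lemma p_dim_carrier_vec:
  shows "has_p_dim p n (carrier_vec n :: 'a mod_ring fls vec set)"
    and "p_dim p n (carrier_vec n :: 'a mod_ring fls vec set) = n * r"
proof -
  obtain bs where bs: "comp_series bs" "span (set bs) = funs_below n" "length bs = n * r"
    using comp_series_funs_below by blast
  obtain ws where ws: "comp_series ws" "set ws \<subseteq> S_funs_below n" "span (set ws) = funs_below n"
    using comp_series_of_finite[of "unit_fun ` {..<n}" n] S_funs_below_closed(3) span_unit_funs by auto
  then have ws': "span (set ws) = fun_of_vec ` carrier_vec n"
    by (simp add: fun_of_vec_image_carrier_vec)
  show "has_p_dim p n (carrier_vec n :: 'a mod_ring fls vec set)"
    using p_dim_eq_length(1)[OF subset_refl ws(1,2) ws'] .
  show "p_dim p n (carrier_vec n :: 'a mod_ring fls vec set) = n * r"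
    using p_dim_eq_length(2)[OF subset_refl ws(1,2) ws']
      comp_series_length_unique[OF ws(1) bs(1)] ws(3) bs by simp
qed

end

theorem corollary3:
  fixes p r n :: nat
    and C :: "'a::nontriv mod_ring fls vec set"
  assumes "prime p" and "r > 1" and "CARD('a) = p ^ r"
    and "conv_code n C"
  shows "has_p_dim p n C \<and> has_p_dim p n (dual_code n C) \<and>
    has_p_dim p n (carrier_vec n :: 'a mod_ring fls vec set) \<and>
    p_dim p n C + p_dim p n (dual_code n C)
      = p_dim p n (carrier_vec n :: 'a mod_ring fls vec set) \<and>
    p_dim p n (carrier_vec n :: 'a mod_ring fls vec set) = n * r"
proof -
  interpret prime_power_mod_ring p r "TYPE('a)"
    using assms(1-3) by unfold_locales auto
  show ?thesis using p_dim_duality[OF assms(4)] p_dim_carrier_vec by simp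
qed

end
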